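(* Let $G$ be a $d$-regular graph on $n$ vertices which is bicycle-free at radius $r \geq 10\ln(2\ell)$. Then the number of singleton-free $(\ell-1)$-hikes in $G$ is at most $$O(\ell^3 n)\cdot (d-1)^{\ell}\cdot (d r \ell)^{O\left(\frac{\log \ell}{r}\right)\cdot \ell}.$$
   Context: An $(\ell-1)$-hike in $G$ is a closed walk of exactly $2(\ell-1)$ steps which is non-backtracking (no step is the reverse of the preceding step) except possibly between the $(\ell-1)$th and $\ell$th steps; it is singleton-free if every undirected edge it traverses is traversed at least twice. A connected multigraph $H$ is bicycle-free if $|E(H)|-|V(H)| \le 0$; $G$ is bicycle-free at radius $r$ if every vertex's distance-$r$ neighborhood is bicycle-free.
   Formalization: The degree is assumed to satisfy d ≥ 2 (and ℓ ≥ 1): for d = 1 and ℓ = 2 a perfect matching has n singleton-free 1-hikes while the bound, containing (d−1)^ℓ, is 0. *)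

theory Defs
  imports Complex_Main "Graph_Theory.Digraph_Component" "Graph_Theory.Shortest_Path"
begin

text \<open>
  An undirected simple graph is the locale \<^verbatim>\<open>graph\<close>: a finite symmetric digraph without loops
  and parallel arcs, in which the undirected edge \<open>{u, v}\<close> is the pair of arcs from \<open>u\<close> to
  \<open>v\<close> and from \<open>v\<close> to \<open>u\<close>.
\<close>

definition uedge :: "('a, 'b) pre_digraph \<Rightarrow> 'b \<Rightarrow> 'a set" where
  "uedge G e = {tail G e, head G e}"

definition uedges :: "('a, 'b) pre_digraph \<Rightarrow> 'a set set" where
  "uedges G = uedge G ` arcs G"

definition regular :: "('a, 'b) pre_digraph \<Rightarrow> nat \<Rightarrow> bool" where
  "regular G d \<longleftrightarrow> (\<forall>v \<in> verts G. out_degree G v = d)"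

definition excess :: "('a, 'b) pre_digraph \<Rightarrow> int" where
  "excess H = int (card (uedges H)) - int (card (verts H))"

text \<open>Only applied to neighborhoods of a vertex, which are connected.\<close>

definition bicycle_free :: "('a, 'b) pre_digraph \<Rightarrow> bool" where
  "bicycle_free H \<longleftrightarrow> excess H \<le> 0"

definition neighborhood :: "('a, 'b) pre_digraph \<Rightarrow> real \<Rightarrow> 'a \<Rightarrow> ('a, 'b) pre_digraph" where
  "neighborhood G r v = G \<restriction> {w \<in> verts G. wf_digraph.\<mu> G (\<lambda>_. 1) v w \<le> ereal r}"

definition bicycle_free_at_radius :: "('a, 'b) pre_digraph \<Rightarrow> real \<Rightarrow> bool" where
  "bicycle_free_at_radius G r \<longleftrightarrow> (\<forall>v \<in> verts G. bicycle_free (neighborhood G r v))"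

definition is_reverse :: "('a, 'b) pre_digraph \<Rightarrow> 'b \<Rightarrow> 'b \<Rightarrow> bool" where
  "is_reverse G e f \<longleftrightarrow> tail G f = head G e \<and> head G f = tail G e"

text \<open>
  A walk is given by its start vertex \<open>u\<close> and its list of arcs \<open>p\<close>, so that there is one empty
  walk per vertex. Step \<open>j\<close> is \<open>p ! (j - 1)\<close>; the turn between steps \<open>k\<close> and \<open>k + 1\<close>, which is
  allowed to backtrack, is therefore the one from \<open>p ! (k - 1)\<close> to \<open>p ! k\<close>. The turn from the last
  step to the first one is not constrained either.
\<close>

definition hike :: "('a, 'b) pre_digraph \<Rightarrow> nat \<Rightarrow> 'a \<Rightarrow> 'b list \<Rightarrow> bool" where
  "hike G k u p \<longleftrightarrow> pre_digraph.awalk G u p u \<and> length p = 2 * k \<and>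
     (\<forall>i. Suc i < length p \<and> Suc i \<noteq> k \<longrightarrow> \<not> is_reverse G (p ! i) (p ! Suc i))"

definition singleton_free :: "('a, 'b) pre_digraph \<Rightarrow> 'b list \<Rightarrow> bool" where
  "singleton_free G p \<longleftrightarrow>
     (\<forall>e \<in> set p. 2 \<le> card {i. i < length p \<and> uedge G (p ! i) = uedge G e})"

definition singleton_free_hikes :: "('a, 'b) pre_digraph \<Rightarrow> nat \<Rightarrow> ('a \<times> 'b list) set" where
  "singleton_free_hikes G k = {(u, p). hike G k u p \<and> singleton_free G p}"

end

theory Submission
  imports Defs
begin

text \<open>
  Two ideas carry the count. First, a subgraph with at most \<open>l\<close> vertices has small excess: grow a
  ball inside it until one more layer enlarges it by a factor of at most \<open>1 + \<delta>\<close>, which happens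
  within radius \<open>r\<close> for \<open>\<delta>\<close> of order \<open>ln l / r\<close>. All edges meeting that ball lie in the next ball,
  which is bicycle-free, so deleting the ball removes at most \<open>1 + \<delta>\<close> edges per vertex; iterate.
  Second, a ball of radius \<open>r\<close> is a tree plus at most one edge, and a non-backtracking walk inside it
  with given ends is determined by how often, and in which direction, it uses the extra edge.

  Now split the steps of a hike into those along a new edge, of which there are at most \<open>l - 1\<close>
  because every edge is used twice, and those along an old edge. A new step costs a factor \<open>d - 1\<close>.
  A stretch of at most \<open>r\<close> old steps is determined, up to few choices, by its end point, which was
  visited before. Apart from the turn, a hike passes from a new to an old edge only after closing
  a cycle, so the number of stretches, and of patterns of new and old steps, is controlled by the
  excess. If \<open>r\<close> exceeds \<open>l - 1\<close>, the first half of the hike alone determines the second up to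
  \<open>O(l)\<close> choices.
\<close>

section \<open>Non-backtracking walks in a tree with one extra edge\<close>

text \<open>Walks are handled as vertex lists from here on. In a graph without parallel arcs, a step
  reverses the one before it exactly when the vertices two places apart agree.\<close>

definition nonbacktracking :: "'a list \<Rightarrow> bool" where
  "nonbacktracking xs \<longleftrightarrow> (\<forall>i. Suc (Suc i) < length xs \<longrightarrow> xs ! i \<noteq> xs ! Suc (Suc i))"

lemma nonbacktracking_rev: "nonbacktracking (rev xs) \<longleftrightarrow> nonbacktracking xs"
proof -
  have "nonbacktracking (rev ys)" if "nonbacktracking ys" for ys :: "'a list"
    unfolding nonbacktracking_def
  proof (intro allI impI)
    fix i assume i: "Suc (Suc i) < length (rev ys)"
    define j where "j = length ys - Suc (Suc (Suc i))"
    have "ys ! j \<noteq> ys ! Suc (Suc j)"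
      using that i unfolding nonbacktracking_def j_def by auto
    moreover have "rev ys ! i = ys ! Suc (Suc j)" "rev ys ! Suc (Suc i) = ys ! j"
      using i by (auto simp: rev_nth j_def Suc_diff_Suc intro!: arg_cong[where f = "(!) ys"])
    ultimately show "rev ys ! i \<noteq> rev ys ! Suc (Suc i)" by simp
  qed
  from this[of xs] this[of "rev xs"] show ?thesis by auto
qed

lemma nonbacktracking_append1: "nonbacktracking (xs @ ys) \<Longrightarrow> nonbacktracking xs"
  unfolding nonbacktracking_def by (auto simp: nth_append split: if_splits)

lemma nonbacktracking_append2: "nonbacktracking (xs @ ys) \<Longrightarrow> nonbacktracking ys"
  using nonbacktracking_append1[of "rev ys" "rev xs"] by (metis nonbacktracking_rev rev_append)

lemma nonbacktracking_ConsD: "nonbacktracking (x # xs) \<Longrightarrow> nonbacktracking xs"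
  using nonbacktracking_append2[of "[x]" xs] by simp

lemma nonbacktracking_Cons3: "nonbacktracking (x # y # z # zs) \<Longrightarrow> x \<noteq> z"
  unfolding nonbacktracking_def by force

lemma nonbacktracking_mid: "nonbacktracking (xs @ [x, y, z] @ zs) \<Longrightarrow> x \<noteq> z"
  using nonbacktracking_append2 nonbacktracking_Cons3 by (metis append_Cons)

section \<open>Uniqueness of non-backtracking walks in a rooted forest\<close>

text \<open>A rooted forest given by its parent pointers \<open>up\<close>. The rank
  \<open>dep\<close> rules out cycles; it only has to decrease towards the root and need not be a
  distance.\<close>

locale parent_relation =
  fixes up :: "'a \<Rightarrow> 'a \<Rightarrow> bool" and dep :: "'a \<Rightarrow> nat"
  assumes up_unique: "up u v \<Longrightarrow> up u w \<Longrightarrow> v = w"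
    and up_dep: "up u v \<Longrightarrow> dep v < dep u"
begin

definition tstep :: "'a \<Rightarrow> 'a \<Rightarrow> bool" where
  "tstep u v \<longleftrightarrow> up u v \<or> up v u"

lemma tstep_sym: "tstep u v \<longleftrightarrow> tstep v u"
  by (auto simp: tstep_def)

text \<open>After a step from parent to child, the only upward step would return to the same unique
  parent and so backtrack. Hence the walk keeps going down.\<close>

lemma descending_walk:
  assumes "successively tstep (x # y # zs)" "nonbacktracking (x # y # zs)" "up y x"
  shows "dep x < dep (last (y # zs))"
  using assms
proof (induction zs arbitrary: x y)
  case Nil
  then show ?case using up_dep by simp
next
  case (Cons z zs)
  have "x \<noteq> z" using Cons.prems nonbacktracking_Cons3 by metis
  then have "up z y" using Cons.prems up_unique by (auto simp: tstep_def)
  then have "dep y < dep (last (z # zs))"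
    using Cons.prems nonbacktracking_ConsD by (intro Cons.IH) auto
  then show ?case using up_dep[OF Cons.prems(3)] by simp
qed

lemma first_step_up:
  assumes "successively tstep (x # y # zs)" "nonbacktracking (x # y # zs)" "dep (last (y # zs)) \<le> dep x"
  shows "up x y"
  using descending_walk[OF assms(1,2)] assms by (auto simp: tstep_def)


text \<open>By induction on the total length. Reversing both walks if necessary, the end is no
  deeper than the start; then both must begin with the step to the unique parent, which can be
  stripped off.\<close>

lemma nb_tree_walk_unique:
  assumes "successively tstep p" "successively tstep q" "nonbacktracking p" "nonbacktracking q"
    and "p \<noteq> []" "q \<noteq> []" "hd p = hd q" "last p = last q"
  shows "p = q"
proof -
  define ok where "ok p q \<longleftrightarrow> successively tstep p \<and> successively tstep q \<and> nonbacktracking p \<and> nonbacktracking q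
    \<and> p \<noteq> [] \<and> q \<noteq> [] \<and> hd p = hd q \<and> last p = last q" for p q
  have ok_sym: "ok p q \<Longrightarrow> ok q p" for p q by (auto simp: ok_def)
  have ok_rev: "ok p q \<Longrightarrow> ok (rev p) (rev q)" for p q
    using tstep_sym by (auto simp: ok_def nonbacktracking_rev hd_rev last_rev)
  have "ok p q \<Longrightarrow> p = q" for p q
  proof (induction "length p + length q" arbitrary: p q rule: less_induct)
    case less
    \<comment> \<open>The case where one walk is a single vertex \<open>x\<close>. The other is then
      closed, and begins and ends with the edge from \<open>x\<close> to its parent
      \<open>y\<close>. Stripping both ends leaves a closed walk at \<open>y\<close>, trivial by
      induction, so the walk was \<open>x, y, x\<close>.\<close>
    have closed: False if ok: "ok p' [x]" and len: "length p' = Suc (Suc m)"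
      and small: "length p' + 1 = length p + length q" for p' x m
    proof -
      obtain y zs where p': "p' = x # y # zs"
        using len ok by (cases p'; cases "tl p'") (auto simp: ok_def)
      have y: "up x y" using ok first_step_up[of x y zs] unfolding p' ok_def by auto
      obtain y' zs' where rp': "rev p' = x # y' # zs'"
        using len ok ok_rev[OF ok] by (cases "rev p'"; cases "tl (rev p')") (auto simp: ok_def)
      have "up x y'" using ok_rev[OF ok] first_step_up[of x y' zs'] unfolding rp' ok_def by auto
      then have yy: "y' = y" using y up_unique by blast
      have p'2: "p' = rev zs' @ [y, x]"
        using rp' yy by (metis append_Cons append_Nil append_assoc rev.simps(2) rev_rev_ident)
      have "zs \<noteq> []"
        using ok up_dep[OF y] unfolding p' ok_def by auto
      moreover have "length p' \<noteq> 3"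
      proof
        assume "length p' = 3"
        then obtain z where "zs = [z]" unfolding p' by (cases zs) auto
        then show False using ok nonbacktracking_Cons3[of x y z "[]"] unfolding p' ok_def by auto
      qed
      ultimately obtain us z where "zs' = us @ [z]" using p' p'2
        by (cases zs' rule: rev_cases) auto
      then have "p' = z # rev us @ [y, x]" using p'2 by simp
      moreover then have "z = x" using p' by simp
      ultimately have p'3: "p' = x # rev us @ [y] @ [x]" by simp
      define mid where "mid = rev us @ [y]"
      have mid: "p' = x # mid @ [x]" using p'3 mid_def by simp
      have "ok mid [y]" unfolding ok_def
      proof (intro conjI)
        show "successively tstep mid" using ok unfolding ok_def mid
          by (auto simp: successively_Cons successively_append_iff)
        show "nonbacktracking mid"
          using ok nonbacktracking_ConsD[of x "mid @ [x]"] nonbacktracking_append1[of mid "[x]"]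
          by (simp add: ok_def mid)
        show "hd mid = hd [y]" using mid p' mid_def by (cases "rev us") auto
        show "nonbacktracking [y]" by (simp add: nonbacktracking_def)
      qed (auto simp: mid_def)
      then have "mid = [y]" using less.hyps[of mid "[y]"] small mid by simp
      then show False using ok mid nonbacktracking_Cons3[of x y x "[]"] by (simp add: ok_def)
    qed
    \<comment> \<open>Stated for any pair of the same total length, so that it also applies to the
      reversed walks.\<close>
    have descend: "p' = q'" if ok: "ok p' q'" and len: "length p' + length q' = length p + length q"
      and le: "dep (last p') \<le> dep (hd p')" for p' q'
    proof -
      obtain x ps qs where p': "p' = x # ps" and q': "q' = x # qs"
        using ok by (cases p'; cases q') (auto simp: ok_def)
      show ?thesis
      proof (cases "ps = [] \<or> qs = []")
        case True
        have "ps = []" if "qs = []"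
          using closed[of p' x "length ps - 1"] ok len that p' q' by (cases ps) auto
        moreover have "qs = []" if "ps = []"
          using closed[of q' x "length qs - 1"] ok_sym[OF ok] len that p' q' by (cases qs) auto
        ultimately show ?thesis using True p' q' by auto
      next
        case False
        then obtain y ys z zs where ps: "ps = y # ys" and qs: "qs = z # zs"
          by (cases ps; cases qs) auto
        have "up x y" using first_step_up[of x y ys] ok le unfolding p' q' ps qs ok_def by auto
        moreover have "up x z" using first_step_up[of x z zs] ok le unfolding p' q' ps qs ok_def by auto
        ultimately have "y = z" using up_unique by blast
        then have "ok ps qs" using ok nonbacktracking_ConsD unfolding p' q' ps qs ok_def by auto
        then show ?thesis using less.hyps[of ps qs] len p' q' by simp
      qed
    qed
    show ?case
    proof (cases "dep (last p) \<le> dep (hd p)")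
      case True
      then show ?thesis using descend less.prems by blast
    next
      case False
      then have "rev p = rev q"
        using ok_rev[OF less.prems] less.prems by (intro descend) (auto simp: last_rev hd_rev ok_def)
      then show ?thesis by simp
    qed
  qed
  then show ?thesis using assms by (simp add: ok_def)
qed

end

section \<open>Traversals of the extra edge\<close>

fun traversals :: "'a set \<Rightarrow> 'a list \<Rightarrow> ('a \<times> 'a) list" where
  "traversals e (x # y # zs) =
     (if {x, y} = e then (x, y) # traversals e (y # zs) else traversals e (y # zs))"
| "traversals e _ = []"

lemma successively_disjD:
  "successively (\<lambda>u v. P u v \<or> Q u v) p \<Longrightarrow> successively (\<lambda>u v. \<not> Q u v) p \<Longrightarrow> successively P p"
  unfolding successively_conv_nth by blast

lemma traversals_NilD:
  "traversals e p = [] \<Longrightarrow> successively (\<lambda>u v. {u, v} \<noteq> e) p"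
  by (induction e p rule: traversals.induct) (auto split: if_splits)

text \<open>Cuts the walk at its first traversal of \<open>e\<close>; the piece before it is a pure
  forest walk. This drives the inductions below.\<close>

lemma traversals_ConsD:
  "traversals e p = (u, v) # ts \<Longrightarrow>
    \<exists>p1 p2. p = p1 @ p2 \<and> p1 \<noteq> [] \<and> p2 \<noteq> [] \<and> last p1 = u \<and> hd p2 = v \<and> {u, v} = e \<and>
      traversals e p1 = [] \<and> traversals e p2 = ts"
proof (induction e p rule: traversals.induct)
  case (1 e x y zs)
  show ?case
  proof (cases "{x, y} = e")
    case True
    then have "u = x" "v = y" "traversals e (y # zs) = ts" using "1.prems" by auto
    then show ?thesis using True by (intro exI[of _ "[x]"] exI[of _ "y # zs"]) simp
  next
    case False
    then have "traversals e (y # zs) = (u, v) # ts" using "1.prems" by simp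
    from "1.IH"(2)[OF False this]
    obtain p1 p2 where *: "y # zs = p1 @ p2" "p1 \<noteq> []" "p2 \<noteq> []" "last p1 = u" "hd p2 = v"
      "{u, v} = e" "traversals e p1 = []" "traversals e p2 = ts"
      by blast
    obtain p1' where "p1 = y # p1'" using * by (cases p1) auto
    then show ?thesis using * False by (intro exI[of _ "x # p1"] exI[of _ p2]) auto
  qed
qed auto

lemma length_traversals: "length (traversals e p) \<le> length p - 1"
proof (induction e p rule: traversals.induct)
  case (1 e x y zs)
  then show ?case by (cases "{x, y} = e") simp_all
qed simp_all

context parent_relation
begin

text \<open>The traversals fix the end points of all pieces between them, and each piece is a
  non-backtracking forest walk, hence unique.\<close>

lemma traversals_determine_nb_walk:
  assumes "successively (\<lambda>u v. tstep u v \<or> {u, v} = e) p" "successively (\<lambda>u v. tstep u v \<or> {u, v} = e) q"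
    and "nonbacktracking p" "nonbacktracking q" "p \<noteq> []" "q \<noteq> []" "hd p = hd q" "last p = last q"
    and "traversals e p = traversals e q"
  shows "p = q"
  using assms
proof (induction "traversals e p" arbitrary: p q)
  case Nil
  have "successively tstep s" if "traversals e s = []" "successively (\<lambda>u v. tstep u v \<or> {u, v} = e) s" for s
    using successively_disjD[OF that(2) traversals_NilD[OF that(1)]] .
  then show ?case using Nil by (intro nb_tree_walk_unique) auto
next
  case (Cons t ts)
  obtain u v where t: "t = (u, v)" by (cases t)
  obtain p1 p2 where p: "p = p1 @ p2" "p1 \<noteq> []" "p2 \<noteq> []" "last p1 = u" "hd p2 = v"
      "{u, v} = e" "traversals e p1 = []" "traversals e p2 = ts"
    using traversals_ConsD[of e p u v ts] Cons.hyps(2) t by auto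
  obtain q1 q2 where q: "q = q1 @ q2" "q1 \<noteq> []" "q2 \<noteq> []" "last q1 = u" "hd q2 = v"
      "traversals e q1 = []" "traversals e q2 = ts"
    using traversals_ConsD[of e q u v ts] Cons.hyps(2) Cons.prems t by auto
  have "p1 = q1"
  proof (rule nb_tree_walk_unique)
    show "successively tstep p1" "successively tstep q1"
      using successively_disjD[OF _ traversals_NilD[OF p(7)]] successively_disjD[OF _ traversals_NilD[OF q(6)]]
        Cons.prems(1,2) unfolding p(1) q(1) successively_append_iff by blast+
    show "nonbacktracking p1" "nonbacktracking q1" using p q Cons.prems nonbacktracking_append1 by auto
  qed (use p q Cons.prems in auto)
  moreover have "p2 = q2"
    using p q Cons.prems nonbacktracking_append2 by (intro Cons.hyps(1)) (auto simp: successively_append_iff)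
  ultimately show ?case using p q by simp
qed

text \<open>If the next traversal went the opposite way, the forest walk between the two would be
  closed, hence trivial, and the walk would backtrack along \<open>e\<close>.\<close>

lemma traversals_same_direction:
  assumes "successively (\<lambda>u v. tstep u v \<or> {u, v} = e) p" "nonbacktracking p" "traversals e p = t # t' # ts"
  shows "t' = t"
proof -
  obtain u v u' v' where t: "t = (u, v)" "t' = (u', v')" by (cases t; cases t')
  obtain p1 p2 where p: "p = p1 @ p2" "p1 \<noteq> []" "p2 \<noteq> []" "last p1 = u" "hd p2 = v"
      "{u, v} = e" "traversals e p2 = (u', v') # ts"
    using traversals_ConsD[of e p u v "(u', v') # ts"] assms(3) t by auto
  obtain p3 p4 where p2: "p2 = p3 @ p4" "p3 \<noteq> []" "p4 \<noteq> []" "last p3 = u'" "hd p4 = v'"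
      "{u', v'} = e" "traversals e p3 = []"
    using traversals_ConsD[of e p2 u' v' ts] p by auto
  show ?thesis
  proof (rule ccontr)
    assume "t' \<noteq> t"
    then have eq: "u' = v" "v' = u" using p(6) p2(6) t by (metis doubleton_eq_iff)+
    have hd3: "hd p3 = v" using p p2 by simp
    have "p3 = [v]"
    proof (rule nb_tree_walk_unique)
      show "successively tstep p3"
        using successively_disjD[OF _ traversals_NilD[OF p2(7)]] assms(1)
        unfolding p(1) p2(1) successively_append_iff by blast
      show "nonbacktracking p3" using p p2 assms(2) nonbacktracking_append1 nonbacktracking_append2 by metis
      show "nonbacktracking [v]" by (simp add: nonbacktracking_def)
    qed (use p2 hd3 eq in auto)
    moreover obtain p1' where "p1 = p1' @ [u]" using p by (metis append_butlast_last_id)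
    moreover obtain p4' where "p4 = u # p4'" using p2 eq by (cases p4) auto
    ultimately have "p = p1' @ [u, v, u] @ p4'" using p p2 by simp
    then show False using nonbacktracking_mid assms(2) by metis
  qed
qed

lemma traversals_replicate:
  assumes "successively (\<lambda>u v. tstep u v \<or> {u, v} = e) p" "nonbacktracking p" "traversals e p = t # ts"
  shows "t # ts = replicate (Suc (length ts)) t"
  using assms
proof (induction ts arbitrary: p t)
  case (Cons t' ts)
  obtain u v where t: "t = (u, v)" by (cases t)
  obtain p1 p2 where p: "p = p1 @ p2" "p1 \<noteq> []" "p2 \<noteq> []" "traversals e p2 = t' # ts"
    using traversals_ConsD[of e p u v "t' # ts"] Cons.prems t by auto
  have "t' = t" using traversals_same_direction Cons.prems by blast
  moreover have "t' # ts = replicate (Suc (length ts)) t'"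
    using p Cons.prems nonbacktracking_append2 by (intro Cons.IH[of p2]) (auto simp: successively_append_iff)
  ultimately show ?case by simp
qed simp

text \<open>The traversal list is an injective code for these walks, and it consists of at most
  \<open>m\<close> copies of \<open>(a, b)\<close> or at most \<open>m\<close> copies of
  \<open>(b, a)\<close>.\<close>

lemma card_nb_walks_le:
  assumes "\<And>p. p \<in> P \<Longrightarrow> successively (\<lambda>u v. tstep u v \<or> {u, v} = {a, b}) p \<and> nonbacktracking p \<and>
      length p = Suc m \<and> hd p = x \<and> last p = y"
  shows "finite P \<and> card P \<le> 2 * Suc m"
proof -
  let ?T = "traversals {a, b}"
  let ?S = "(\<lambda>j. replicate j (a, b)) ` {..m} \<union> (\<lambda>j. replicate j (b, a)) ` {..m}"
  have inj: "inj_on ?T P"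
  proof (rule inj_onI)
    fix p q assume "p \<in> P" "q \<in> P" "?T p = ?T q"
    then show "p = q" using assms[of p] assms[of q]
      by (intro traversals_determine_nb_walk[of "{a, b}"]) auto
  qed
  have sub: "?T ` P \<subseteq> ?S"
  proof
    fix ts assume "ts \<in> ?T ` P"
    then obtain p where p: "p \<in> P" "ts = ?T p" by auto
    have len: "length ts \<le> m" using length_traversals[of "{a, b}" p] assms[OF p(1)] p by simp
    show "ts \<in> ?S"
    proof (cases ts)
      case Nil
      then show ?thesis by (auto intro!: image_eqI[of _ _ 0])
    next
      case (Cons t ts')
      have "ts = replicate (length ts) t"
        using traversals_replicate[of "{a, b}" p t ts'] assms[OF p(1)] p(2) Cons
        by (metis length_Cons)
      moreover have "t = (a, b) \<or> t = (b, a)"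
        using traversals_ConsD[of "{a, b}" p "fst t" "snd t" ts'] p Cons
        by (cases t) (auto simp: doubleton_eq_iff)
      ultimately show ?thesis using len by auto
    qed
  qed
  have fin: "finite ?S" by auto
  have "card ?S \<le> card ((\<lambda>j. replicate j (a, b)) ` {..m}) + card ((\<lambda>j. replicate j (b, a)) ` {..m})"
    by (rule card_Un_le)
  also have "\<dots> \<le> card {..m} + card {..m}"
    by (intro add_mono card_image_le) auto
  finally have "card ?S \<le> 2 * Suc m" by simp
  moreover have "card P \<le> card ?S" using card_inj_on_le[OF inj sub fin] .
  moreover have "finite P" using inj_on_finite[OF inj sub fin] .
  ultimately show ?thesis by simp
qed

end

section \<open>Balls in bicycle-free graphs\<close>

locale ugraph =
  fixes V :: "'a set" and adj :: "'a \<Rightarrow> 'a \<Rightarrow> bool"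
  assumes finite_V: "finite V"
    and adj_sym: "adj u v \<Longrightarrow> adj v u"
    and adj_V: "adj u v \<Longrightarrow> u \<in> V"
begin

lemma adj_V2: "adj u v \<Longrightarrow> v \<in> V"
  using adj_V adj_sym by blast

primrec ball :: "'a \<Rightarrow> nat \<Rightarrow> 'a set" where
  "ball x 0 = {x}"
| "ball x (Suc i) = ball x i \<union> {w. \<exists>u\<in>ball x i. adj u w}"

definition edges_in :: "'a set \<Rightarrow> 'a set set" where
  "edges_in X = {{u, w} | u w. u \<in> X \<and> w \<in> X \<and> adj u w}"

lemma finite_edges_in: "finite X \<Longrightarrow> finite (edges_in X)"
  by (rule finite_subset[of _ "Pow X"]) (auto simp: edges_in_def)

lemma ball_subset: "x \<in> V \<Longrightarrow> ball x i \<subseteq> V"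
  using adj_V2 by (induction i) auto

lemma finite_ball: "x \<in> V \<Longrightarrow> finite (ball x i)"
  using ball_subset finite_V finite_subset by blast

lemma ball_mono: "i \<le> j \<Longrightarrow> ball x i \<subseteq> ball x j"
  by (induction rule: dec_induct) auto

lemma walk_in_ball:
  assumes "successively adj p" "p \<noteq> []" "i < length p"
  shows "p ! i \<in> ball (hd p) i"
  using assms(3)
proof (induction i)
  case 0
  then show ?case using assms(2) by (simp add: hd_conv_nth)
next
  case (Suc i)
  then have "adj (p ! i) (p ! Suc i)" using assms(1) successively_nth by blast
  then show ?case using Suc by auto
qed

section \<open>Breadth-first search trees\<close>

definition depth :: "'a \<Rightarrow> 'a \<Rightarrow> nat" where
  "depth x w = (LEAST i. w \<in> ball x i)"

text \<open>At \<open>w = x\<close> no vertex of smaller depth exists and the value is arbitrary, so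
  every use excludes the root.\<close>

definition parent :: "'a \<Rightarrow> 'a \<Rightarrow> 'a" where
  "parent x w = (SOME u. adj u w \<and> u \<in> ball x (depth x w) \<and> depth x u < depth x w)"

text \<open>A vertex other than \<open>x\<close> first appears in some layer \<open>Suc j\<close>,
  so it has a neighbour in the ball of radius \<open>j\<close>.\<close>

lemma parent:
  assumes "w \<in> ball x i" "w \<noteq> x"
  shows "adj (parent x w) w" "parent x w \<in> ball x i" "depth x (parent x w) < depth x w"
proof -
  have w: "w \<in> ball x (depth x w)" and le: "depth x w \<le> i"
    using assms(1) unfolding depth_def by (auto intro: LeastI Least_le)
  obtain j where j: "depth x w = Suc j" using w assms(2) by (cases "depth x w") auto
  have "w \<notin> ball x j" using not_less_Least[of j "\<lambda>i. w \<in> ball x i"] j unfolding depth_def by simp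
  then obtain u where u: "u \<in> ball x j" "adj u w" using w j by auto
  have "depth x u < depth x w"
    using u(1) j unfolding depth_def by (metis Least_le less_Suc_eq_le)
  then have "\<exists>u. adj u w \<and> u \<in> ball x (depth x w) \<and> depth x u < depth x w"
    using u j by auto
  from someI_ex[OF this] show "adj (parent x w) w" "parent x w \<in> ball x i"
      "depth x (parent x w) < depth x w"
    using ball_mono[OF le] unfolding parent_def by auto
qed

text \<open>Two vertices sharing a parent edge would each be the parent of the other, against the
  decrease of depth.\<close>

lemma inj_on_parent_edge: "inj_on (\<lambda>w. {w, parent x w}) (ball x i - {x})"
proof (rule inj_onI)
  fix w w' assume "w \<in> ball x i - {x}" "w' \<in> ball x i - {x}" "{w, parent x w} = {w', parent x w'}"
  then show "w = w'" using parent(3)[of w x i] parent(3)[of w' x i]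
    by (fastforce simp: doubleton_eq_iff)
qed

lemma parent_edge_in: "w \<in> ball x i - {x} \<Longrightarrow> {w, parent x w} \<in> edges_in (ball x i)"
  using parent[of w x i] adj_sym unfolding edges_in_def by blast

lemma up_depth: "parent_relation (\<lambda>u v. u \<in> ball x i - {x} \<and> v = parent x u) (depth x)"
  by unfold_locales (auto simp: parent)

end

section \<open>Edge and walk counts in bicycle-free graphs\<close>

locale bicycle_free_graph = ugraph +
  fixes R :: nat
  assumes bicycle_free: "x \<in> V \<Longrightarrow> card (edges_in (ball x R)) \<le> card (ball x R)"
begin

text \<open>Bicycle-freeness passes to subsets of the ball containing the centre: each vertex of the
  ball outside \<open>J\<close> contributes its own parent edge, and these edges are distinct and
  not inside \<open>J\<close>.\<close>

lemma card_edges_le: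
  assumes x: "x \<in> V" "x \<in> J" and J: "J \<subseteq> ball x R" and F: "F \<subseteq> edges_in J"
  shows "card F \<le> card J"
proof -
  let ?B = "ball x R" and ?pe = "\<lambda>w. {w, parent x w}"
  have fin: "finite ?B" "finite (edges_in ?B)" "finite J"
    using finite_ball[OF x(1)] finite_edges_in finite_subset[OF J] by auto
  have FB: "F \<subseteq> edges_in ?B" using F J unfolding edges_in_def by blast
  then have finF: "finite F" using fin finite_subset by blast
  have disj: "F \<inter> ?pe ` (?B - J) = {}"
    using F unfolding edges_in_def by (auto simp: doubleton_eq_iff)
  have inj: "inj_on ?pe (?B - J)"
    by (rule inj_on_subset[OF inj_on_parent_edge[of x R]]) (use x in auto)
  have sub: "?pe ` (?B - J) \<subseteq> edges_in ?B"
    using parent_edge_in[of _ x R] x by blast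
  have "card F + card (?B - J) = card (F \<union> ?pe ` (?B - J))"
    using card_Un_disjoint[OF finF _ disj] card_image[OF inj] fin by simp
  also have "\<dots> \<le> card (edges_in ?B)" using FB sub fin by (intro card_mono) auto
  also have "\<dots> \<le> card ?B" using bicycle_free x by simp
  finally show ?thesis using card_Diff_subset[OF fin(3) J] card_mono[OF fin(1) J] by linarith
qed

lemma card_edges_le_growth:
  fixes \<delta> :: real
  assumes R: "0 < R" and \<delta>: "0 \<le> \<delta>" "real N \<le> (1 + \<delta>) ^ R"
    and "X \<subseteq> V" "card X \<le> N" "F \<subseteq> edges_in X"
  shows "real (card F) \<le> (1 + \<delta>) * real (card X)"
  using assms(4-6)
proof (induction "card X" arbitrary: X F rule: less_induct)
  case less
  have finX: "finite X" using less.prems finite_V finite_subset by blast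
  have finF: "finite F" using less.prems finite_edges_in[OF finX] finite_subset by blast
  show ?case
  proof (cases "X = {}")
    case True
    then show ?thesis using less.prems by (auto simp: edges_in_def)
  next
    case False
    then obtain x where x: "x \<in> X" by auto
    \<comment> \<open>The ball is grown along edges of \<open>F\<close> only, so it stays inside
      \<open>X\<close> and also inside the ball of the whole graph.\<close>
    define B where "B = rec_nat {x} (\<lambda>_ Y. Y \<union> {w \<in> X. \<exists>u\<in>Y. {u, w} \<in> F})"
    have B0: "B 0 = {x}" and BS: "B (Suc i) = B i \<union> {w \<in> X. \<exists>u\<in>B i. {u, w} \<in> F}" for i
      by (auto simp: B_def)
    have BX: "B i \<subseteq> X" and xB: "x \<in> B i" for i
      using x by (induction i) (auto simp: B0 BS)
    have Fadj: "adj u w" if uw: "{u, w} \<in> F" for u w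
    proof -
      have "{u, w} \<in> edges_in X" using uw less.prems by blast
      then obtain u' w' where "{u, w} = {u', w'}" "adj u' w'"
        unfolding edges_in_def by blast
      then show ?thesis using adj_sym by (auto simp: doubleton_eq_iff)
    qed
    have Bball: "B i \<subseteq> ball x i" for i
      using Fadj by (induction i) (auto simp: B0 BS)
    have finB: "finite (B i)" for i using BX finX finite_subset by blast
    \<comment> \<open>If all \<open>R\<close> layers grew by a factor above
      \<open>1 + \<delta>\<close>, the last set would have more than
      \<open>(1 + \<delta>) ^ R\<close> elements, at least \<open>N\<close>, although it lies in
      \<open>X\<close>.\<close>
    have "\<exists>i<R. real (card (B (Suc i))) \<le> (1 + \<delta>) * real (card (B i))"
    proof (rule ccontr)
      assume "\<not> ?thesis"
      then have grow: "(1 + \<delta>) * real (card (B i)) < real (card (B (Suc i)))" if "i < R" for i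
        using that by (auto simp: not_le)
      \<comment> \<open>The strict part for positive \<open>i\<close> is what contradicts
        \<open>N \<le> (1 + \<delta>) ^ R\<close>.\<close>
      have big: "(1 + \<delta>) ^ i \<le> real (card (B i)) \<and> (0 < i \<longrightarrow> (1 + \<delta>) ^ i < real (card (B i)))"
        if "i \<le> R" for i
        using that
      proof (induction i)
        case 0
        then show ?case by (simp add: B0)
      next
        case (Suc i)
        have "(1 + \<delta>) ^ Suc i \<le> (1 + \<delta>) * real (card (B i))"
          using Suc \<delta> by (simp add: mult_left_mono)
        then show ?case using grow[of i] Suc by linarith
      qed
      show False
      proof -
        have "real N < real (card (B R))" using big[of R] \<delta> R by linarith
        also have "\<dots> \<le> real (card X)" using card_mono[OF finX BX] by simp
        finally show False using less.prems by simp
      qed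
    qed
    then obtain i where i: "i < R" "real (card (B (Suc i))) \<le> (1 + \<delta>) * real (card (B i))" by auto
    \<comment> \<open>The edges removed together with \<open>B i\<close>; both their ends lie in the
      next layer, where bicycle-freeness bounds their number.\<close>
    define F1 where "F1 = {e \<in> F. e \<inter> B i \<noteq> {}}"
    have "F1 \<subseteq> edges_in (B (Suc i))"
    proof
      fix e assume e: "e \<in> F1"
      then have "e \<in> edges_in X" using less.prems by (auto simp: F1_def)
      then obtain u w where uw: "e = {u, w}" "u \<in> X" "w \<in> X" "adj u w"
        unfolding edges_in_def by blast
      then have "u \<in> B (Suc i)" "w \<in> B (Suc i)"
        using e by (auto simp: F1_def BS insert_commute)
      then show "e \<in> edges_in (B (Suc i))" using uw by (auto simp: edges_in_def)
    qed
    moreover have "B (Suc i) \<subseteq> ball x R" using Bball[of "Suc i"] ball_mono[of "Suc i" R x] i by auto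
    ultimately have "card F1 \<le> card (B (Suc i))"
      using card_edges_le[of x "B (Suc i)" F1] x xB less.prems by blast
    then have F1: "real (card F1) \<le> (1 + \<delta>) * real (card (B i))" using i(2) by linarith
    have cX: "card X = card (B i) + card (X - B i)"
      using card_Diff_subset[OF finB BX[of i]] card_mono[OF finX BX[of i]] by simp
    have "card (B i) > 0" using xB finB card_gt_0_iff by blast
    then have "real (card (F - F1)) \<le> (1 + \<delta>) * real (card (X - B i))"
    proof (intro less.hyps)
      show "F - F1 \<subseteq> edges_in (X - B i)"
      proof
        fix e assume e: "e \<in> F - F1"
        then have "e \<in> edges_in X" using less.prems by blast
        then obtain u w where "e = {u, w}" "u \<in> X" "w \<in> X" "adj u w"
          unfolding edges_in_def by blast
        then show "e \<in> edges_in (X - B i)" using e by (auto simp: F1_def edges_in_def)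
      qed
    qed (use less.prems cX in auto)
    moreover have "card F = card F1 + card (F - F1)"
      using finF F1_def card_Diff_subset[of F1 F] card_mono[of F F1] by auto
    ultimately show ?thesis using F1 cX by (simp add: algebra_simps)
  qed
qed

text \<open>Read backwards, the walk starts at \<open>y\<close> and so stays in the ball about
  \<open>y\<close>. That ball has at most as many edges as vertices, and the parent edges account
  for all but at most one of them.\<close>

lemma card_nb_walks_between_le:
  fixes x y :: 'a
  assumes y: "y \<in> V" and m: "m \<le> R"
  defines "P \<equiv> {p. length p = Suc m \<and> successively adj p \<and> nonbacktracking p \<and> hd p = x \<and> last p = y}"
  shows "finite P \<and> card P \<le> 2 * Suc m"
proof -
  let ?B = "ball y R" and ?pe = "\<lambda>w. {w, parent y w}"
  interpret parent_relation "\<lambda>u v. u \<in> ?B - {y} \<and> v = parent y u" "depth y"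
    by (rule up_depth)
  have fin: "finite ?B" "finite (edges_in ?B)" using finite_ball[OF y] finite_edges_in by auto
  have yB: "y \<in> ?B" using ball_mono[of 0 R y] by auto
  have sub: "?pe ` (?B - {y}) \<subseteq> edges_in ?B" using parent_edge_in[of _ y R] by blast
  have "card (edges_in ?B - ?pe ` (?B - {y})) = card (edges_in ?B) - card (?B - {y})"
    using card_Diff_subset[OF _ sub] card_image[OF inj_on_parent_edge[of y R]] fin by simp
  also have "\<dots> \<le> 1" using bicycle_free[OF y] yB fin by simp
  \<comment> \<open>If every edge is a parent edge, any \<open>a\<close> and \<open>b\<close> serve:
    allowing one more edge only enlarges the set that is counted.\<close>
  finally have "\<exists>a b. edges_in ?B - ?pe ` (?B - {y}) \<subseteq> {{a, b}}"
  proof (cases "edges_in ?B - ?pe ` (?B - {y}) = {}")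
    case False
    then obtain e where e: "e \<in> edges_in ?B" "e \<notin> ?pe ` (?B - {y})" by auto
    obtain a b where "e = {a, b}" using e by (auto simp: edges_in_def)
    moreover assume "card (edges_in ?B - ?pe ` (?B - {y})) \<le> 1"
    then have "edges_in ?B - ?pe ` (?B - {y}) \<subseteq> {e}"
      using e fin card_le_Suc0_iff_eq[of "edges_in ?B - ?pe ` (?B - {y})"] by auto
    ultimately show ?thesis by auto
  qed auto
  then obtain a b where ab: "edges_in ?B - ?pe ` (?B - {y}) \<subseteq> {{a, b}}" by auto
  show ?thesis
  proof (rule card_nb_walks_le)
    fix p assume p: "p \<in> P"
    then have ne: "p \<noteq> []" by (auto simp: P_def)
    have "set p \<subseteq> ?B"
    proof
      fix v assume "v \<in> set p"
      then obtain i where i: "i < length (rev p)" "v = rev p ! i"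
        by (metis in_set_conv_nth set_rev)
      have "successively adj (rev p)" using p adj_sym by (auto simp: P_def elim: successively_mono)
      then have "v \<in> ball (hd (rev p)) i" using walk_in_ball[of "rev p" i] i ne by simp
      then show "v \<in> ?B" using p i m ball_mono[of i R y] by (auto simp: P_def hd_rev)
    qed
    have "successively (\<lambda>u v. tstep u v \<or> {u, v} = {a, b}) p"
      unfolding successively_conv_nth
    proof (intro allI impI)
      fix i assume i: "Suc i < length p"
      then have "p ! i \<in> ?B" "p ! Suc i \<in> ?B" using \<open>set p \<subseteq> ?B\<close> by (auto dest: nth_mem)
      moreover have "adj (p ! i) (p ! Suc i)" using i p successively_nth[of adj p i] by (auto simp: P_def)
      ultimately have "{p ! i, p ! Suc i} \<in> edges_in ?B" by (auto simp: edges_in_def)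
      then have "{p ! i, p ! Suc i} = {a, b} \<or> {p ! i, p ! Suc i} \<in> ?pe ` (?B - {y})" using ab by blast
      then show "tstep (p ! i) (p ! Suc i) \<or> {p ! i, p ! Suc i} = {a, b}"
        unfolding tstep_def by (auto simp: doubleton_eq_iff)
    qed
    then show "successively (\<lambda>u v. tstep u v \<or> {u, v} = {a, b}) p \<and> nonbacktracking p \<and>
      length p = Suc m \<and> hd p = x \<and> last p = y"
      using p by (auto simp: P_def)
  qed
qed

end

section \<open>Counting hikes by vertex sequences\<close>

lemma card_le_fibres:
  assumes "finite A" "\<And>y. y \<in> f ` A \<Longrightarrow> card {x \<in> A. f x = y} \<le> c"
  shows "card A \<le> c * card (f ` A)"
proof -
  have "A = (\<Union>y\<in>f ` A. {x \<in> A. f x = y})" by auto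
  then have "card A \<le> (\<Sum>y\<in>f ` A. card {x \<in> A. f x = y})"
    using card_UN_le[of "f ` A" "\<lambda>y. {x \<in> A. f x = y}"] assms(1) by simp
  also have "\<dots> \<le> (\<Sum>y\<in>f ` A. c)" by (rule sum_mono) (use assms in auto)
  finally show ?thesis by (simp add: mult.commute)
qed

section \<open>Extending prefixes of walks\<close>

locale hike_graph = bicycle_free_graph +
  fixes d k :: nat
  assumes degree_le: "card {v. adj u v} \<le> d"
    and d_ge_2: "2 \<le> d" and k_pos: "0 < k" and R_pos: "0 < R"
begin

text \<open>Here \<open>k\<close> is \<open>l - 1\<close>, and \<open>Suc i \<noteq> k\<close>
  exempts the turn at vertex \<open>k\<close>. That the walk is closed is imposed separately where
  it is used.\<close>

definition walks :: "'a list set" where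
  "walks = {xs. length xs = Suc (2 * k) \<and> hd xs \<in> V \<and> successively adj xs \<and>
     (\<forall>i. Suc (Suc i) < length xs \<and> Suc i \<noteq> k \<longrightarrow> xs ! i \<noteq> xs ! Suc (Suc i))}"

lemma walksD:
  assumes "xs \<in> walks"
  shows "length xs = Suc (2 * k)" "hd xs \<in> V" "successively adj xs" "xs \<noteq> []"
    "Suc i \<le> 2 * k \<Longrightarrow> adj (xs ! i) (xs ! Suc i)"
    "Suc (Suc i) \<le> 2 * k \<Longrightarrow> Suc i \<noteq> k \<Longrightarrow> xs ! i \<noteq> xs ! Suc (Suc i)"
  using assms by (auto simp: walks_def successively_conv_nth)

lemma set_walk:
  assumes "xs \<in> walks"
  shows "set xs \<subseteq> V"
proof
  fix v assume "v \<in> set xs"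
  then obtain i where i: "i < length xs" "v = xs ! i" by (metis in_set_conv_nth)
  show "v \<in> V"
  proof (cases i)
    case 0
    then show ?thesis using i walksD[OF assms] by (simp add: hd_conv_nth)
  next
    case (Suc j)
    then show ?thesis using i walksD(1)[OF assms] walksD(5)[OF assms, of j] adj_V2 by auto
  qed
qed

lemma finite_walks: "finite walks"
  by (rule finite_subset[OF _ finite_lists_length_eq[OF finite_V, of "Suc (2 * k)"]])
    (use set_walk walksD(1) in blast)

definition step_factor :: "nat \<Rightarrow> nat" where
  "step_factor t = (if t = 0 \<or> t = k then d else d - 1)"

lemma card_prefixes_0:
  assumes "S \<subseteq> walks"
  shows "card (take (Suc 0) ` S) \<le> card V"
proof -
  have "take (Suc 0) ` S \<subseteq> (\<lambda>v. [v]) ` V"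
  proof
    fix ys assume "ys \<in> take (Suc 0) ` S"
    then obtain xs where xs: "xs \<in> walks" "ys = take (Suc 0) xs" using assms by auto
    then have "ys = [hd xs]" using walksD(4)[OF xs(1)] by (cases xs) auto
    then show "ys \<in> (\<lambda>v. [v]) ` V" using walksD(2)[OF xs(1)] by auto
  qed
  then have "card (take (Suc 0) ` S) \<le> card ((\<lambda>v. [v]) ` V)"
    using finite_V by (intro card_mono) auto
  also have "\<dots> \<le> card V" using finite_V by (rule card_image_le)
  finally show ?thesis .
qed

text \<open>The prefix of \<open>Suc t\<close> vertices has made \<open>t\<close> steps. Its
  extensions go to neighbours of its last vertex other than the previous vertex, except at the start
  and at the turn, where all neighbours are allowed.\<close>

lemma card_prefixes_Suc:
  assumes S: "S \<subseteq> walks" and t: "t < 2 * k"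
  shows "card (take (Suc (Suc t)) ` S) \<le> step_factor t * card (take (Suc t) ` S)"
proof -
  let ?A = "take (Suc (Suc t)) ` S"
  have img: "take (Suc t) ` ?A = take (Suc t) ` S"
    by (auto simp: image_image min_def)
  have "card ?A \<le> step_factor t * card (take (Suc t) ` ?A)"
  proof (rule card_le_fibres)
    show "finite ?A" using S finite_walks finite_subset by blast
    fix ys assume "ys \<in> take (Suc t) ` ?A"
    then obtain xs0 where xs0: "xs0 \<in> S" "ys = take (Suc t) xs0" using img by auto
    have len: "length ys = Suc t" using xs0 S walksD(1)[of xs0] t by auto
    define N where "N = {v. adj (ys ! t) v} - (if t = 0 \<or> t = k then {} else {ys ! (t - 1)})"
    have sub: "{zs \<in> ?A. take (Suc t) zs = ys} \<subseteq> (\<lambda>v. ys @ [v]) ` N"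
    proof
      fix zs assume "zs \<in> {zs \<in> ?A. take (Suc t) zs = ys}"
      then obtain xs where xs: "xs \<in> S" "zs = take (Suc (Suc t)) xs" "take (Suc t) xs = ys"
        by (auto simp: min_def)
      have w: "xs \<in> walks" using xs S by auto
      have zs: "zs = ys @ [xs ! Suc t]"
        using xs walksD(1)[OF w] t take_Suc_conv_app_nth[of "Suc t" xs] by simp
      have yt: "ys ! i = xs ! i" if "i \<le> t" for i using xs(3) that by auto
      have "xs ! Suc t \<in> N"
        using walksD(5)[OF w, of t] walksD(6)[OF w, of "t - 1"] t yt by (auto simp: N_def)
      then show "zs \<in> (\<lambda>v. ys @ [v]) ` N" using zs by auto
    qed
    have finN: "finite {v. adj (ys ! t) v}"
      using finite_V adj_V2 by (auto intro: finite_subset[of _ V])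
    then have "card {zs \<in> ?A. take (Suc t) zs = ys} \<le> card ((\<lambda>v. ys @ [v]) ` N)"
      using sub by (intro card_mono) (auto simp: N_def)
    also have "\<dots> \<le> card N" using finN by (intro card_image_le) (auto simp: N_def)
    also have "\<dots> \<le> step_factor t"
    proof (cases "t = 0 \<or> t = k")
      case True
      then show ?thesis using degree_le[of "ys ! t"] by (auto simp: N_def step_factor_def)
    next
      case False
      have w: "xs0 \<in> walks" using xs0 S by auto
      have "adj (xs0 ! (t - 1)) (xs0 ! Suc (t - 1))" using walksD(5)[OF w, of "t - 1"] t False by auto
      then have "ys ! (t - 1) \<in> {v. adj (ys ! t) v}" using xs0(2) False adj_sym by auto
      then have "card N = card {v. adj (ys ! t) v} - 1" using False by (simp add: N_def)
      then show ?thesis using degree_le[of "ys ! t"] False by (auto simp: step_factor_def)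
    qed
    finally show "card {zs \<in> ?A. take (Suc t) zs = ys} \<le> step_factor t" .
  qed
  then show ?thesis using img by simp
qed

text \<open>The steps from \<open>s\<close> to \<open>t\<close> form a non-backtracking walk of at
  most \<open>R\<close> steps, since the turn can only be at one of its ends. The prefix leaves
  \<open>c\<close> candidates for its last vertex, and \<open>2 * Suc (t - s)\<close> walks lead to
  each.\<close>

lemma card_prefixes_segment:
  assumes S: "S \<subseteq> walks" and st: "s \<le> t" "t \<le> 2 * k" "t - s \<le> R"
    and noturn: "\<And>j. s < j \<Longrightarrow> j < t \<Longrightarrow> j \<noteq> k"
    and Y: "\<And>xs. xs \<in> S \<Longrightarrow> xs ! t \<in> Y (take (Suc s) xs)"
    and cardY: "\<And>ys. ys \<in> take (Suc s) ` S \<Longrightarrow> finite (Y ys) \<and> Y ys \<subseteq> V \<and> card (Y ys) \<le> c"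
  shows "card (take (Suc t) ` S) \<le> c * (2 * Suc (t - s)) * card (take (Suc s) ` S)"
proof -
  let ?A = "take (Suc t) ` S"
  have img: "take (Suc s) ` ?A = take (Suc s) ` S"
    using st by (auto simp: image_image min_def)
  have "card ?A \<le> c * (2 * Suc (t - s)) * card (take (Suc s) ` ?A)"
  proof (rule card_le_fibres)
    show "finite ?A" using S finite_walks finite_subset by blast
    fix ys assume "ys \<in> take (Suc s) ` ?A"
    then have ys: "ys \<in> take (Suc s) ` S" using img by auto
    define P where "P y = {p. length p = Suc (t - s) \<and> successively adj p \<and> nonbacktracking p \<and>
      hd p = ys ! s \<and> last p = y}" for y
    have P: "finite (P y) \<and> card (P y) \<le> 2 * Suc (t - s)" if "y \<in> V" for y
      unfolding P_def using card_nb_walks_between_le[OF that st(3)] .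
    have sub: "{zs \<in> ?A. take (Suc s) zs = ys} \<subseteq> (\<lambda>p. ys @ tl p) ` (\<Union>y\<in>Y ys. P y)"
    proof
      fix zs assume "zs \<in> {zs \<in> ?A. take (Suc s) zs = ys}"
      then obtain xs where xs: "xs \<in> S" "zs = take (Suc t) xs" "take (Suc s) xs = ys"
        using st by (auto simp: min_def)
      have w: "xs \<in> walks" using xs S by auto
      note len = walksD(1)[OF w]
      define p where "p = drop s zs"
      have lp: "length p = Suc (t - s)" using len st xs by (auto simp: p_def)
      have pn: "p ! i = xs ! (s + i)" if "i \<le> t - s" for i
        using that st len xs by (auto simp: p_def)
      have "tl p = drop (Suc s) zs" by (simp add: p_def drop_Suc tl_drop)
      moreover have "ys = take (Suc s) zs" using xs st by (simp add: min_def)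
      ultimately have "zs = ys @ tl p" by simp
      moreover have "p \<in> P (xs ! t)" unfolding P_def
      proof (intro CollectI conjI)
        show "successively adj p" unfolding successively_conv_nth
          using lp pn walksD(5)[OF w] st by auto
        show "nonbacktracking p" unfolding nonbacktracking_def
        proof (intro allI impI)
          fix i assume i: "Suc (Suc i) < length p"
          then have "Suc (s + i) \<noteq> k" using noturn[of "Suc (s + i)"] lp by auto
          then show "p ! i \<noteq> p ! Suc (Suc i)"
            using walksD(6)[OF w, of "s + i"] pn[of i] pn[of "Suc (Suc i)"] i lp st by auto
        qed
        have "p \<noteq> []" using lp by auto
        then show "hd p = ys ! s" using pn[of 0] xs(3) by (auto simp: hd_conv_nth)
        show "last p = xs ! t" using pn[of "t - s"] \<open>p \<noteq> []\<close> lp st by (simp add: last_conv_nth)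
      qed (rule lp)
      moreover have "xs ! t \<in> Y ys" using Y[OF xs(1)] xs(3) by simp
      ultimately show "zs \<in> (\<lambda>p. ys @ tl p) ` (\<Union>y\<in>Y ys. P y)" by blast
    qed
    have fin: "finite (\<Union>y\<in>Y ys. P y)" using cardY[OF ys] P by blast
    then have "card {zs \<in> ?A. take (Suc s) zs = ys} \<le> card ((\<lambda>p. ys @ tl p) ` (\<Union>y\<in>Y ys. P y))"
      using sub by (intro card_mono) auto
    also have "\<dots> \<le> card (\<Union>y\<in>Y ys. P y)" by (rule card_image_le[OF fin])
    also have "\<dots> \<le> (\<Sum>y\<in>Y ys. card (P y))" using cardY[OF ys] by (intro card_UN_le) auto
    also have "\<dots> \<le> (\<Sum>y\<in>Y ys. 2 * Suc (t - s))" using cardY[OF ys] P by (intro sum_mono) blast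
    also have "\<dots> \<le> c * (2 * Suc (t - s))" using cardY[OF ys] by (simp only: sum_constant of_nat_id mult_le_mono1)
    finally show "card {zs \<in> ?A. take (Suc s) zs = ys} \<le> c * (2 * Suc (t - s))" .
  qed
  then show ?thesis using img by simp
qed

lemma take_walks: "S \<subseteq> walks \<Longrightarrow> take (Suc (2 * k)) ` S = S"
  using walksD(1) by (force simp: image_iff)

text \<open>The first half is counted step by step. The second half is a single segment whose end is
  known to be the start vertex.\<close>

lemma card_closed_walks_le:
  assumes "k \<le> R"
  shows "card {xs \<in> walks. last xs = hd xs} \<le> card V * d * (d - 1) ^ (k - 1) * (2 * Suc k)"
proof -
  let ?S = "{xs \<in> walks. last xs = hd xs}"
  have S: "?S \<subseteq> walks" by auto
  have first: "card (take (Suc t) ` ?S) \<le> card V * (d * (d - 1) ^ (t - 1))" if "t \<le> k" "0 < t" for t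
    using that
  proof (induction t)
    case (Suc t)
    show ?case
    proof (cases "t = 0")
      case True
      have "card (take (Suc (Suc 0)) ` ?S) \<le> d * card (take (Suc 0) ` ?S)"
        using card_prefixes_Suc[OF S, of 0] k_pos by (simp add: step_factor_def)
      also have "\<dots> \<le> d * card V" using card_prefixes_0[OF S] by simp
      finally show ?thesis using True by (simp add: mult.commute)
    next
      case False
      have "card (take (Suc (Suc t)) ` ?S) \<le> (d - 1) * card (take (Suc t) ` ?S)"
        using card_prefixes_Suc[OF S, of t] Suc.prems False by (simp add: step_factor_def)
      also have "\<dots> \<le> (d - 1) * (card V * (d * (d - 1) ^ (t - 1)))"
        using Suc False by (intro mult_le_mono2) auto
      also have "\<dots> = card V * (d * (d - 1) ^ (Suc t - 1))"
        using False by (cases t) (simp_all add: ac_simps)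
      finally show ?thesis .
    qed
  qed simp
  have "card (take (Suc (2 * k)) ` ?S) \<le> 1 * (2 * Suc (2 * k - k)) * card (take (Suc k) ` ?S)"
  proof (rule card_prefixes_segment[OF S, where Y = "\<lambda>ys. {hd ys}"])
    fix xs assume "xs \<in> ?S"
    then show "xs ! (2 * k) \<in> {hd (take (Suc k) xs)}"
      using walksD(1,4)[of xs] by (auto simp: last_conv_nth)
  next
    fix ys assume "ys \<in> take (Suc k) ` ?S"
    then show "finite {hd ys} \<and> {hd ys} \<subseteq> V \<and> card {hd ys} \<le> 1"
      using walksD(2) by auto
  qed (use assms in auto)
  also have "\<dots> \<le> 1 * (2 * Suc (2 * k - k)) * (card V * (d * (d - 1) ^ (k - 1)))"
    using first[of k] k_pos by (intro mult_le_mono2) auto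
  finally show ?thesis using take_walks[OF S] by (simp add: algebra_simps)
qed

end

section \<open>Counting sets of positions\<close>

lemma prod_if_const:
  fixes c :: nat
  assumes "finite A"
  shows "(\<Prod>j\<in>A. if Q j then c else 1) = c ^ card {j \<in> A. Q j}"
proof -
  have "(\<Prod>j\<in>A. if Q j then c else 1) = (\<Prod>j\<in>{j \<in> A. Q j}. c)"
    by (rule prod.inter_filter[OF assms, symmetric])
  then show ?thesis by simp
qed

lemma card_multiples_le:
  assumes "0 < (R::nat)"
  shows "card {j. j < n \<and> R dvd j} \<le> Suc (n div R)"
proof -
  have "{j. j < n \<and> R dvd j} \<subseteq> (\<lambda>i. R * i) ` {..n div R}"
  proof
    fix j assume "j \<in> {j. j < n \<and> R dvd j}"
    then obtain i where "j = R * i" "j < n" by auto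
    then show "j \<in> (\<lambda>i. R * i) ` {..n div R}"
      using assms by (auto intro!: image_eqI[of _ _ i] simp: less_eq_div_iff_mult_less_eq mult.commute)
  qed
  then have "card {j. j < n \<and> R dvd j} \<le> card ((\<lambda>i. R * i) ` {..n div R})"
    by (intro card_mono) auto
  also have "\<dots> \<le> Suc (n div R)" using card_image_le[of "{..n div R}" "\<lambda>i. R * i"] by simp
  finally show ?thesis .
qed

text \<open>Starting inside \<open>T\<close>, exits and entries alternate and an exit comes first.
  The extra summand stands for a last exit without a return; it makes the claim an equation, which
  the induction needs.\<close>

lemma card_entries_le_exits:
  fixes T :: "nat set"
  assumes "0 \<in> T"
  shows "card {s. 0 < s \<and> s < n \<and> s \<in> T \<and> s - 1 \<notin> T} + (if 0 < n \<and> n - 1 \<notin> T then 1 else 0)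
    = card {s. 0 < s \<and> s < n \<and> s \<notin> T \<and> s - 1 \<in> T}"
proof (induction n)
  case (Suc n)
  show ?case
  proof (cases "n = 0")
    case True
    have empty: "{s. 0 < s \<and> s < Suc 0 \<and> P s} = {}" for P by auto
    show ?thesis unfolding True empty using assms by simp
  next
    case False
    have split: "{s. 0 < s \<and> s < Suc n \<and> P s} =
        (if P n then insert n {s. 0 < s \<and> s < n \<and> P s} else {s. 0 < s \<and> s < n \<and> P s})" for P
      using False by (auto simp: less_Suc_eq)
    show ?thesis using Suc False by (auto simp: split)
  qed
qed simp

text \<open>A set of at most \<open>q\<close> elements is listed with exactly \<open>q\<close>
  entries, padded by the value \<open>n\<close>, which lies outside every \<open>T\<close>.\<close>

lemma card_small_subsets_le:
  assumes "\<And>T. T \<in> \<T> \<Longrightarrow> T \<subseteq> {..<n::nat} \<and> card T \<le> q"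
  shows "card \<T> \<le> Suc n ^ q"
proof -
  let ?L = "{xs. set xs \<subseteq> {..n} \<and> length xs = q}"
  have "\<T> \<subseteq> (\<lambda>xs. set xs \<inter> {..<n}) ` ?L"
  proof
    fix T assume "T \<in> \<T>"
    then have T: "T \<subseteq> {..<n}" "card T \<le> q" using assms by auto
    then have "finite T" using finite_subset by blast
    then obtain ys where ys: "set ys = T" "length ys = card T"
      using finite_distinct_list distinct_card by metis
    have "T = set (ys @ replicate (q - card T) n) \<inter> {..<n}" using ys T by auto
    moreover have "ys @ replicate (q - card T) n \<in> ?L" using ys T by auto
    ultimately show "T \<in> (\<lambda>xs. set xs \<inter> {..<n}) ` ?L" by blast
  qed
  then have "card \<T> \<le> card ((\<lambda>xs. set xs \<inter> {..<n}) ` ?L)"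
    by (intro card_mono finite_imageI finite_lists_length_eq) auto
  also have "\<dots> \<le> card ?L" by (intro card_image_le finite_lists_length_eq) auto
  also have "\<dots> = Suc n ^ q" by (simp add: card_lists_length_eq)
  finally show ?thesis .
qed

lemma eq_of_transitions_eq:
  fixes T T' :: "nat set"
  assumes "T \<subseteq> {..<n}" "T' \<subseteq> {..<n}" "0 \<in> T" "0 \<in> T'"
    and tr: "{s. 0 < s \<and> s < n \<and> (s \<in> T) \<noteq> (s - 1 \<in> T)} = {s. 0 < s \<and> s < n \<and> (s \<in> T') \<noteq> (s - 1 \<in> T')}"
  shows "T = T'"
proof -
  have "s < n \<Longrightarrow> s \<in> T \<longleftrightarrow> s \<in> T'" for s
  proof (induction s)
    case (Suc s)
    have "(Suc s \<in> T) \<noteq> (s \<in> T) \<longleftrightarrow> (Suc s \<in> T') \<noteq> (s \<in> T')"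
      using eqset_imp_iff[OF tr, of "Suc s"] Suc.prems by simp
    then show ?case using Suc by auto
  qed (use assms in auto)
  then show ?thesis using assms by auto
qed

section \<open>New steps, old steps and the excess\<close>

context hike_graph
begin

definition step_edge :: "'a list \<Rightarrow> nat \<Rightarrow> 'a set" where
  "step_edge xs i = {xs ! i, xs ! Suc i}"

definition new_steps :: "'a list \<Rightarrow> nat set" where
  "new_steps xs = {s. s < 2 * k \<and> (\<forall>i<s. step_edge xs i \<noteq> step_edge xs s)}"

text \<open>The steps that discover a vertex. A new step that is not fresh closes a cycle, so these
  are the ones the excess controls.\<close>

definition fresh_steps :: "'a list \<Rightarrow> nat set" where
  "fresh_steps xs = {s. s < 2 * k \<and> (\<forall>i\<le>s. xs ! i \<noteq> xs ! Suc s)}"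

definition exits :: "nat set \<Rightarrow> nat set" where
  "exits T = {s. 0 < s \<and> s < 2 * k \<and> s \<notin> T \<and> s - 1 \<in> T}"

lemma finite_new_steps: "finite (new_steps xs)"
  by (rule finite_subset[of _ "{..<2 * k}"]) (auto simp: new_steps_def)

lemma finite_exits: "finite (exits T)"
  by (rule finite_subset[of _ "{..<2 * k}"]) (auto simp: exits_def)

lemma zero_new: "0 \<in> new_steps xs"
  using k_pos by (simp add: new_steps_def)

lemma old_step_edge:
  assumes "i < 2 * k"
  shows "\<exists>j\<in>new_steps xs. j \<le> i \<and> step_edge xs j = step_edge xs i"
  using assms
proof (induction i rule: less_induct)
  case (less i)
  show ?case
  proof (cases "i \<in> new_steps xs")
    case False
    then obtain j where "j < i" "step_edge xs j = step_edge xs i"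
      using less.prems by (auto simp: new_steps_def)
    moreover then obtain j' where "j' \<in> new_steps xs" "j' \<le> j" "step_edge xs j' = step_edge xs j"
      using less.IH[of j] less.prems by auto
    ultimately show ?thesis by (intro bexI[of _ j']) auto
  qed auto
qed

lemma card_new_steps: "card (new_steps xs) = card (step_edge xs ` {..<2 * k})"
proof -
  have "step_edge xs ` {..<2 * k} = step_edge xs ` new_steps xs"
  proof
    show "step_edge xs ` {..<2 * k} \<subseteq> step_edge xs ` new_steps xs"
      using old_step_edge[of _ xs] by (metis image_eqI image_subsetI lessThan_iff)
  qed (auto simp: new_steps_def)
  moreover have "inj_on (step_edge xs) (new_steps xs)"
    by (rule inj_onI) (metis (mono_tags, lifting) linorder_neqE_nat mem_Collect_eq new_steps_def)
  ultimately show ?thesis by (simp add: card_image)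
qed

lemma fresh_subset_new: "fresh_steps xs \<subseteq> new_steps xs"
  by (auto simp: fresh_steps_def new_steps_def step_edge_def doubleton_eq_iff)

text \<open>Every vertex except the start is first reached by a fresh step.\<close>

lemma card_set_le_fresh:
  assumes "length xs = Suc (2 * k)"
  shows "card (set xs) \<le> Suc (card (fresh_steps xs))"
proof -
  have "set xs \<subseteq> insert (xs ! 0) ((\<lambda>s. xs ! Suc s) ` fresh_steps xs)"
  proof
    fix v assume v: "v \<in> set xs"
    define i where "i = (LEAST i. i < length xs \<and> xs ! i = v)"
    have i: "i < length xs" "xs ! i = v"
      using LeastI_ex[of "\<lambda>i. i < length xs \<and> xs ! i = v"] v unfolding i_def in_set_conv_nth by auto
    have least: "xs ! j \<noteq> v" if "j < i" for j
      using not_less_Least[of j "\<lambda>i. i < length xs \<and> xs ! i = v"] that i unfolding i_def by auto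
    show "v \<in> insert (xs ! 0) ((\<lambda>s. xs ! Suc s) ` fresh_steps xs)"
    proof (cases i)
      case (Suc s)
      then have "s \<in> fresh_steps xs" using i least assms by (auto simp: fresh_steps_def)
      then show ?thesis using i Suc by auto
    qed (use i in auto)
  qed
  moreover have fin: "finite (fresh_steps xs)"
    using fresh_subset_new finite_new_steps finite_subset by blast
  ultimately have "card (set xs) \<le> card (insert (xs ! 0) ((\<lambda>s. xs ! Suc s) ` fresh_steps xs))"
    by (intro card_mono) auto
  also have "\<dots> \<le> Suc (card (fresh_steps xs))"
    using fin card_image_le[OF fin, of "\<lambda>s. xs ! Suc s"] by (simp add: card_insert_if)
  finally show ?thesis .
qed

text \<open>A walk that has just reached a fresh vertex can return to an old edge only by backtracking,
  so outside the turn it does so only after closing a cycle.\<close>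
lemma exits_subset:
  assumes w: "xs \<in> walks"
  shows "exits (new_steps xs) \<subseteq> insert k (Suc ` (new_steps xs - fresh_steps xs))"
proof
  fix s assume s: "s \<in> exits (new_steps xs)"
  then obtain t where t: "s = Suc t" "Suc t < 2 * k" "Suc t \<notin> new_steps xs" "t \<in> new_steps xs"
    by (cases s) (auto simp: exits_def)
  show "s \<in> insert k (Suc ` (new_steps xs - fresh_steps xs))"
  proof (cases "s = k \<or> t \<notin> fresh_steps xs")
    case False
    then have fresh: "xs ! i \<noteq> xs ! Suc t" if "i \<le> t" for i using that by (auto simp: fresh_steps_def)
    obtain j where j: "j < Suc t" "step_edge xs j = step_edge xs (Suc t)"
      using t by (auto simp: new_steps_def)
    \<comment> \<open>An earlier traversal of the same edge already touches the newly reached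
      vertex, so it can only be the step \<open>t\<close> that reached it.\<close>
    then have "xs ! Suc t \<in> {xs ! j, xs ! Suc j}" by (auto simp: step_edge_def)
    then have "xs ! Suc t = xs ! Suc j" using fresh[of j] j by auto
    then have "j = t" using fresh[of "Suc j"] j by (cases "j = t") auto
    then have "xs ! Suc (Suc t) = xs ! t"
      using j fresh[of t] by (auto simp: step_edge_def doubleton_eq_iff)
    then show ?thesis using walksD(6)[OF w, of t] t False by auto
  qed (use t in auto)
qed

text \<open>The turn accounts for one exit; the others follow a new step that is not fresh. New
  steps count the edges of the trace, and fresh steps its vertices up to one, so the growth bound on
  edges applies. Its vertex set has at most \<open>Suc k\<close> elements.\<close>

lemma card_exits_le:
  fixes \<delta> :: real
  assumes w: "xs \<in> walks" and new: "card (new_steps xs) \<le> k"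
    and \<delta>: "0 \<le> \<delta>" "real (Suc k) \<le> (1 + \<delta>) ^ R"
  shows "real (card (exits (new_steps xs))) \<le> 2 + \<delta> * real (Suc k)"
proof -
  let ?N = "new_steps xs" and ?F = "fresh_steps xs"
  note fin = finite_new_steps[of xs]
  have finF: "finite ?F" using fresh_subset_new fin finite_subset by blast
  have cF: "card ?F \<le> card ?N" using fresh_subset_new fin by (rule card_mono[rotated])
  have cV: "card (set xs) \<le> Suc (card ?F)" by (rule card_set_le_fresh[OF walksD(1)[OF w]])
  then have cVk: "card (set xs) \<le> Suc k" using cF new by linarith
  have "step_edge xs ` {..<2 * k} \<subseteq> edges_in (set xs)"
    using walksD(1)[OF w] walksD(5)[OF w] by (fastforce simp: step_edge_def edges_in_def)
  then have "real (card ?N) \<le> (1 + \<delta>) * real (card (set xs))"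
    unfolding card_new_steps
    by (intro card_edges_le_growth[OF R_pos \<delta> set_walk[OF w] cVk])
  also have "\<dots> \<le> real (card (set xs)) + \<delta> * real (Suc k)"
    using cVk \<delta> by (simp add: distrib_right mult_left_mono del: of_nat_Suc)
  finally have excess: "real (card ?N) \<le> real (card (set xs)) + \<delta> * real (Suc k)" .
  have "card (exits ?N) \<le> card (insert k (Suc ` (?N - ?F)))"
    using exits_subset[OF w] fin by (intro card_mono) auto
  also have "\<dots> \<le> Suc (card (Suc ` (?N - ?F)))" using fin by (simp add: card_insert_if)
  also have "card (Suc ` (?N - ?F)) = card ?N - card ?F"
    using card_Diff_subset[OF finF fresh_subset_new] by (simp add: card_image)
  finally have "card (exits ?N) + card ?F \<le> Suc (card ?N)" using cF by linarith
  then have "real (card (exits ?N)) + real (card ?F) \<le> 1 + real (card ?N)" by linarith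
  then show ?thesis using excess cV by linarith
qed

text \<open>The cuts divide the old steps into segments of at most \<open>R\<close> steps that do not contain the
  turn, so that each segment is a non-backtracking walk inside one ball.\<close>
definition is_cut :: "nat set \<Rightarrow> nat \<Rightarrow> bool" where
  "is_cut T j \<longleftrightarrow> j = k \<or> R dvd j \<or> (0 < j \<and> j - 1 \<in> T)"

text \<open>At most \<open>2k + 1\<close> visited vertices can be the end of a segment, and at most
  \<open>2 * Suc R\<close> walks lead to each.\<close>

definition segment_factor :: nat where
  "segment_factor = Suc (2 * k) * (2 * Suc R)"

text \<open>The whole cost of a segment of old steps is charged to the cut where it begins; its
  other steps are free.\<close>

definition pattern_factor :: "nat set \<Rightarrow> nat \<Rightarrow> nat" where
  "pattern_factor T j =
     (if j \<in> T then step_factor j else if is_cut T j then segment_factor else 1)"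

text \<open>By induction on \<open>t\<close>. A last step that is new extends the prefix by one
  vertex; a last step that is old is treated together with everything back to the last cut as one
  segment.\<close>

lemma card_prefixes_pattern:
  assumes S: "S \<subseteq> walks" and T: "\<And>xs. xs \<in> S \<Longrightarrow> new_steps xs = T" and "t \<le> 2 * k"
  shows "card (take (Suc t) ` S) \<le> card V * (\<Prod>j<t. pattern_factor T j)"
  using assms(3)
proof (induction t rule: less_induct)
  case (less t)
  show ?case
  proof (cases t)
    case 0
    then show ?thesis using card_prefixes_0[OF S] by simp
  next
    case (Suc t')
    show ?thesis
    proof (cases "t' \<in> T")
      case True
      have "card (take (Suc t) ` S) \<le> step_factor t' * card (take (Suc t') ` S)"
        using card_prefixes_Suc[OF S, of t'] Suc less.prems by simp
      also have "\<dots> \<le> step_factor t' * (card V * (\<Prod>j<t'. pattern_factor T j))"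
        using less.IH[of t'] less.prems Suc by (intro mult_le_mono2) auto
      also have "\<dots> = card V * (\<Prod>j<t. pattern_factor T j)"
        using Suc True by (simp add: pattern_factor_def)
      finally show ?thesis .
    next
      case False
      define s where "s = Max {j. j < t \<and> is_cut T j}"
      have fin: "finite {j. j < t \<and> is_cut T j}" by auto
      have "0 \<in> {j. j < t \<and> is_cut T j}" using Suc by (auto simp: is_cut_def)
      then have s: "s < t" "is_cut T s" using Max_in[OF fin] unfolding s_def by blast+
      have no_cut: "\<not> is_cut T j" if "s < j" "j < t" for j
        using Max_ge[OF fin, of j] that unfolding s_def by (metis leD mem_Collect_eq)
      \<comment> \<open>A new step at \<open>j\<close> would make \<open>Suc j\<close> a
        cut.\<close>
      have old: "j \<notin> T" if "s \<le> j" "j < t" for j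
      proof (cases "j = t'")
        case False
        then have "\<not> is_cut T (Suc j)" using that Suc by (intro no_cut) auto
        then show ?thesis by (auto simp: is_cut_def)
      qed (use \<open>t' \<notin> T\<close> in simp)
      have len: "t - s \<le> R"
      proof (rule ccontr)
        assume "\<not> t - s \<le> R"
        \<comment> \<open>The next multiple of \<open>R\<close> after \<open>s\<close>, which is a
          cut.\<close>
        define j where "j = R * (s div R) + R"
        have "s < j" "j \<le> s + R" using R_pos mult_div_mod_eq[of R s] mod_less_divisor[of R s]
          unfolding j_def by linarith+
        moreover have "R dvd j" by (simp add: j_def)
        moreover have "j < t" using \<open>j \<le> s + R\<close> \<open>\<not> t - s \<le> R\<close> by linarith
        ultimately show False using no_cut[of j] by (auto simp: is_cut_def)
      qed
      have "card (take (Suc t) ` S) \<le> Suc (2 * k) * (2 * Suc (t - s)) * card (take (Suc s) ` S)"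
      proof (rule card_prefixes_segment[OF S, where Y = set])
        fix xs assume xs: "xs \<in> S"
        have "t' < 2 * k" using less.prems Suc by simp
        \<comment> \<open>The last step retraces an edge first used at \<open>j\<close>. All steps
          from \<open>s\<close> on are old, so \<open>j < s\<close> and the vertex reached was
          visited by position \<open>s\<close>.\<close>
        then obtain j where j: "j \<in> T" "j \<le> t'" "step_edge xs j = step_edge xs t'"
          using old_step_edge[of t' xs] T[OF xs] by auto
        then have "j < s" using old[of j] Suc by (meson le_imp_less_Suc not_le)
        moreover have "xs ! t \<in> step_edge xs j" using j Suc by (simp add: step_edge_def)
        moreover have "xs ! i \<in> set (take (Suc s) xs)" if "i \<le> s" for i
          unfolding in_set_conv_nth using that xs S walksD(1)[of xs] s less.prems
          by (intro exI[of _ i]) auto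
        ultimately show "xs ! t \<in> set (take (Suc s) xs)" by (auto simp: step_edge_def)
      next
        fix ys assume "ys \<in> take (Suc s) ` S"
        then obtain xs where xs: "xs \<in> walks" "ys = take (Suc s) xs" using S by auto
        have "set ys \<subseteq> V" using set_walk[OF xs(1)] xs(2) set_take_subset by fast
        moreover have "card (set ys) \<le> Suc (2 * k)"
          using card_length[of ys] xs walksD(1)[OF xs(1)] by simp
        ultimately show "finite (set ys) \<and> set ys \<subseteq> V \<and> card (set ys) \<le> Suc (2 * k)" by simp
      qed (use s less.prems len no_cut in \<open>auto simp: is_cut_def\<close>)
      also have "\<dots> \<le> segment_factor * (card V * (\<Prod>j<s. pattern_factor T j))"
        unfolding segment_factor_def using less.IH[of s] s less.prems len
        by (intro mult_le_mono) auto
      also have "\<dots> = card V * (\<Prod>j<t. pattern_factor T j)"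
      proof -
        have "{..<t} = {..<s} \<union> {s} \<union> {s<..<t}" using s by auto
        then have "(\<Prod>j<t. pattern_factor T j) = (\<Prod>j\<in>{..<s} \<union> {s} \<union> {s<..<t}. pattern_factor T j)"
          by simp
        also have "\<dots> = (\<Prod>j<s. pattern_factor T j) * pattern_factor T s * (\<Prod>j\<in>{s<..<t}. pattern_factor T j)"
          by (subst prod.union_disjoint) auto
        also have "(\<Prod>j\<in>{s<..<t}. pattern_factor T j) = 1"
          using no_cut old by (intro prod.neutral) (auto simp: pattern_factor_def)
        also have "pattern_factor T s = segment_factor"
          using s old[of s] by (simp add: pattern_factor_def)
        finally show ?thesis by simp
      qed
      finally show ?thesis .
    qed
  qed
qed

text \<open>The factor \<open>d\<close> occurs only at positions \<open>0\<close> and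
  \<open>k\<close>, and \<open>d - 1\<close> at most once per new step. The cuts are the turn, at
  most \<open>Suc (2 * k div R)\<close> multiples of \<open>R\<close>, and the exits.\<close>

lemma prod_pattern_factor_le:
  assumes T: "T \<subseteq> {..<2 * k}" "card T \<le> k" and q: "card (exits T) \<le> q"
  shows "(\<Prod>j<2 * k. pattern_factor T j) \<le>
    d\<^sup>2 * (d - 1) ^ k * segment_factor ^ (q + 2 + 2 * k div R)"
proof -
  let ?A = "{..<2 * k}"
  have d1: "1 \<le> d - 1" using d_ge_2 by simp
  have M1: "1 \<le> segment_factor" by (simp add: segment_factor_def)
  have "(\<Prod>j<2 * k. pattern_factor T j) \<le> (\<Prod>j<2 * k. (if j = 0 \<or> j = k then d else 1) *
      (if j \<in> T then d - 1 else 1) * (if j \<notin> T \<and> is_cut T j then segment_factor else 1))"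
    using d1 M1 d_ge_2 by (intro prod_mono) (auto simp: pattern_factor_def step_factor_def)
  also have "\<dots> = d ^ card {j \<in> ?A. j = 0 \<or> j = k} * (d - 1) ^ card {j \<in> ?A. j \<in> T} *
      segment_factor ^ card {j \<in> ?A. j \<notin> T \<and> is_cut T j}"
    by (simp only: prod.distrib prod_if_const[OF finite_lessThan])
  also have "\<dots> \<le> d\<^sup>2 * (d - 1) ^ k * segment_factor ^ (q + 2 + 2 * k div R)"
  proof (intro mult_le_mono power_increasing)
    have "card {j \<in> ?A. j = 0 \<or> j = k} \<le> card {0, k}" by (intro card_mono) auto
    also have "\<dots> \<le> 2" by (simp add: card_insert_if)
    finally show "card {j \<in> ?A. j = 0 \<or> j = k} \<le> 2" .
    have "{j \<in> ?A. j \<in> T} = T" using T by auto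
    then show "card {j \<in> ?A. j \<in> T} \<le> k" using T by simp
    have "{j \<in> ?A. j \<notin> T \<and> is_cut T j} \<subseteq> insert k ({j. j < 2 * k \<and> R dvd j} \<union> exits T)"
      by (auto simp: is_cut_def exits_def)
    then have "card {j \<in> ?A. j \<notin> T \<and> is_cut T j} \<le> card (insert k ({j. j < 2 * k \<and> R dvd j} \<union> exits T))"
      using finite_exits by (intro card_mono) auto
    also have "\<dots> \<le> Suc (card ({j. j < 2 * k \<and> R dvd j} \<union> exits T))"
      using finite_exits by (simp add: card_insert_if)
    also have "\<dots> \<le> Suc (card {j. j < 2 * k \<and> R dvd j} + card (exits T))"
      by (simp add: card_Un_le)
    also have "\<dots> \<le> q + 2 + 2 * k div R"
      using card_multiples_le[OF R_pos, of "2 * k"] q by simp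
    finally show "card {j \<in> ?A. j \<notin> T \<and> is_cut T j} \<le> q + 2 + 2 * k div R" .
  qed (use d1 M1 d_ge_2 in auto)
  finally show ?thesis .
qed

text \<open>A pattern containing \<open>0\<close> is determined by its exits and entries, and there
  are no more entries than exits.\<close>

lemma card_patterns_le:
  assumes \<T>: "\<And>T. T \<in> \<T> \<Longrightarrow> T \<subseteq> {..<2 * k} \<and> 0 \<in> T \<and> card (exits T) \<le> q"
  shows "card \<T> \<le> Suc (2 * k) ^ (2 * q)"
proof -
  define tr where "tr T = {s. 0 < s \<and> s < 2 * k \<and> (s \<in> T) \<noteq> (s - 1 \<in> T)}" for T
  have inj: "inj_on tr \<T>"
  proof (rule inj_onI)
    fix T T' assume "T \<in> \<T>" "T' \<in> \<T>" "tr T = tr T'"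
    then show "T = T'" using \<T>[of T] \<T>[of T'] unfolding tr_def
      by (intro eq_of_transitions_eq[of T "2 * k" T']) auto
  qed
  have "card (tr ` \<T>) \<le> Suc (2 * k) ^ (2 * q)"
  proof (rule card_small_subsets_le)
    fix X assume "X \<in> tr ` \<T>"
    then obtain T where T: "T \<in> \<T>" "X = tr T" by auto
    let ?E = "{s. 0 < s \<and> s < 2 * k \<and> s \<in> T \<and> s - 1 \<notin> T}"
    have "X = ?E \<union> exits T" using T by (auto simp: tr_def exits_def)
    then have "card X \<le> card ?E + card (exits T)" using card_Un_le by metis
    moreover have "card ?E \<le> card (exits T)"
      using card_entries_le_exits[of T "2 * k"] \<T>[OF T(1)] by (simp add: exits_def)
    moreover have "X \<subseteq> {..<2 * k}" using T by (auto simp: tr_def)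
    ultimately show "X \<subseteq> {..<2 * k} \<and> card X \<le> 2 * q" using \<T>[OF T(1)] by auto
  qed
  then show ?thesis using card_image[OF inj] by simp
qed

text \<open>Walks are grouped by their set of new steps: the number of patterns is multiplied by the
  bound for a single pattern.\<close>

lemma card_walks_few_edges_le:
  fixes \<delta> :: real
  assumes \<delta>: "0 \<le> \<delta>" "real (Suc k) \<le> (1 + \<delta>) ^ R" and q: "2 + \<delta> * real (Suc k) < real (Suc q)"
  shows "card {xs \<in> walks. card (step_edge xs ` {..<2 * k}) \<le> k} \<le>
    card V * d\<^sup>2 * (d - 1) ^ k * (Suc (2 * k) ^ (2 * q) * segment_factor ^ (q + 2 + 2 * k div R))"
proof -
  let ?S = "{xs \<in> walks. card (step_edge xs ` {..<2 * k}) \<le> k}"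
  let ?c = "card V * (d\<^sup>2 * (d - 1) ^ k * segment_factor ^ (q + 2 + 2 * k div R))"
  have T: "T \<subseteq> {..<2 * k} \<and> 0 \<in> T \<and> card T \<le> k \<and> card (exits T) \<le> q" if TS: "T \<in> new_steps ` ?S" for T
  proof -
    obtain xs where xs: "xs \<in> walks" "card (new_steps xs) \<le> k" "T = new_steps xs"
      using TS card_new_steps by auto
    \<comment> \<open>Strictness turns the real bound on the exits into the integer bound
      \<open>q\<close>.\<close>
    have "real (card (exits T)) < real (Suc q)"
      using card_exits_le[OF xs(1,2) \<delta>] q xs(3) by simp
    then show ?thesis using xs zero_new by (auto simp: new_steps_def)
  qed
  have "card ?S \<le> ?c * card (new_steps ` ?S)"
  proof (rule card_le_fibres)
    show "finite ?S" using finite_walks by simp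
    fix T assume TS: "T \<in> new_steps ` ?S"
    let ?ST = "{xs \<in> ?S. new_steps xs = T}"
    have sub: "?ST \<subseteq> walks" by auto
    have "card (take (Suc (2 * k)) ` ?ST) \<le> card V * (\<Prod>j<2 * k. pattern_factor T j)"
      by (rule card_prefixes_pattern[OF sub]) auto
    also have "\<dots> \<le> ?c" using prod_pattern_factor_le[of T q] T[OF TS] by (intro mult_le_mono2) auto
    finally show "card ?ST \<le> ?c" using take_walks[OF sub] by simp
  qed
  also have "\<dots> \<le> ?c * Suc (2 * k) ^ (2 * q)"
    using T by (intro mult_le_mono2 card_patterns_le) blast
  finally show ?thesis by (simp only: ac_simps)
qed

end

section \<open>Hikes as arc walks\<close>

lemma card_image_ge_fibres:
  assumes "finite A" "\<And>y. y \<in> f ` A \<Longrightarrow> c \<le> card {x \<in> A. f x = y}"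
  shows "c * card (f ` A) \<le> card A"
proof -
  have "c * card (f ` A) = (\<Sum>y\<in>f ` A. c)" by simp
  also have "\<dots> \<le> (\<Sum>y\<in>f ` A. card {x \<in> A. f x = y})" by (rule sum_mono) (use assms in auto)
  also have "\<dots> = card A" using sum.image_gen[OF assms(1), of "\<lambda>_. 1::nat" f] by simp
  finally show ?thesis .
qed

section \<open>From arc walks to vertex sequences\<close>

context graph
begin

lemma ugraph_verts: "ugraph (verts G) (\<lambda>u v. u \<rightarrow>\<^bsub>G\<^esub> v)"
proof
  show "u \<rightarrow>\<^bsub>G\<^esub> v \<Longrightarrow> v \<rightarrow>\<^bsub>G\<^esub> u" for u v using arcs_ends_symmetric[OF sym_arcs] .
  show "u \<rightarrow>\<^bsub>G\<^esub> v \<Longrightarrow> u \<in> verts G" for u v by (auto simp: arcs_ends_conv)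
qed simp

sublocale U: ugraph "verts G" "\<lambda>u v. u \<rightarrow>\<^bsub>G\<^esub> v"
  by (rule ugraph_verts)

lemma ball_iff_awalk:
  assumes "x \<in> verts G"
  shows "w \<in> U.ball x i \<longleftrightarrow> (\<exists>p. awalk x p w \<and> length p \<le> i)"
proof
  show "w \<in> U.ball x i \<Longrightarrow> \<exists>p. awalk x p w \<and> length p \<le> i"
  proof (induction i arbitrary: w)
    case 0
    then show ?case using assms by (auto simp: awalk_Nil_iff)
  next
    case (Suc i)
    show ?case
    proof (cases "w \<in> U.ball x i")
      case True
      then show ?thesis using Suc.IH le_SucI by blast
    next
      case False
      then obtain u where u: "u \<in> U.ball x i" "u \<rightarrow>\<^bsub>G\<^esub> w" using Suc.prems by auto
      then obtain e where "e \<in> arcs G" "tail G e = u" "head G e = w" by blast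
      then have "awalk u [e] w" using arc_implies_awalk by blast
      moreover obtain p where "awalk x p u" "length p \<le> i" using Suc.IH u by blast
      ultimately have "awalk x (p @ [e]) w" "length (p @ [e]) \<le> Suc i"
        using awalk_appendI by auto
      then show ?thesis by blast
    qed
  qed
next
  have "awalk x p w \<Longrightarrow> w \<in> U.ball x (length p)" for p
  proof (induction p arbitrary: w rule: rev_induct)
    case Nil
    then show ?case by (simp add: awalk_Nil_iff)
  next
    case (snoc e p)
    then obtain u where "awalk x p u" "awalk u [e] w" by auto
    then have "u \<in> U.ball x (length p)" "u \<rightarrow>\<^bsub>G\<^esub> w"
      using snoc.IH by (auto simp: awalk_Cons_iff awalk_Nil_iff in_arcs_imp_in_arcs_ends)
    then show ?case by auto
  qed
  then show "\<exists>p. awalk x p w \<and> length p \<le> i \<Longrightarrow> w \<in> U.ball x i"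
    using U.ball_mono by blast
qed

lemma awalk_cost_one: "awalk_cost (\<lambda>_. 1) p = real (length p)"
  by (induction p) auto

text \<open>Walk lengths are integers, so radius \<open>r\<close> and radius
  \<open>\<lfloor>r\<rfloor>\<close> give the same neighborhood.\<close>

lemma verts_neighborhood:
  assumes x: "x \<in> verts G" and r: "0 \<le> r"
  shows "{w \<in> verts G. \<mu> (\<lambda>_. 1) x w \<le> ereal r} = U.ball x (nat \<lfloor>r\<rfloor>)"
proof (intro set_eqI iffI)
  fix w assume "w \<in> {w \<in> verts G. \<mu> (\<lambda>_. 1) x w \<le> ereal r}"
  then have "\<mu> (\<lambda>_. 1) x w \<le> ereal r" by simp
  also have "\<dots> < ereal (real (Suc (nat \<lfloor>r\<rfloor>)))" using r by (simp, linarith)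
  finally obtain p where "awalk x p w" "length p < Suc (nat \<lfloor>r\<rfloor>)"
    unfolding \<mu>_def INF_less_iff awalk_cost_one by auto
  then show "w \<in> U.ball x (nat \<lfloor>r\<rfloor>)" using ball_iff_awalk[OF x] by auto
next
  fix w assume w: "w \<in> U.ball x (nat \<lfloor>r\<rfloor>)"
  then obtain p where p: "awalk x p w" "length p \<le> nat \<lfloor>r\<rfloor>" using ball_iff_awalk[OF x] by auto
  have "\<mu> (\<lambda>_. 1) x w \<le> ereal (awalk_cost (\<lambda>_. 1) p)" by (rule min_cost_le_walk_cost[OF p(1)])
  also have "\<dots> \<le> ereal r" using p(2) r unfolding awalk_cost_one by (simp, linarith)
  finally show "w \<in> {w \<in> verts G. \<mu> (\<lambda>_. 1) x w \<le> ereal r}" using U.ball_subset[OF x] w by auto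
qed

lemma uedges_induce: "uedges (G \<restriction> S) = U.edges_in S"
proof (intro equalityI subsetI)
  fix e assume "e \<in> uedges (G \<restriction> S)"
  then obtain a where "a \<in> arcs G" "tail G a \<in> S" "head G a \<in> S" "e = {tail G a, head G a}"
    by (auto simp: uedges_def uedge_def)
  then show "e \<in> U.edges_in S" using in_arcs_imp_in_arcs_ends unfolding U.edges_in_def by blast
next
  fix e assume "e \<in> U.edges_in S"
  then obtain u w where uw: "e = {u, w}" "u \<in> S" "w \<in> S" "u \<rightarrow>\<^bsub>G\<^esub> w"
    unfolding U.edges_in_def by blast
  then obtain a where "a \<in> arcs G" "tail G a = u" "head G a = w" by blast
  then show "e \<in> uedges (G \<restriction> S)" using uw by (auto simp: uedges_def uedge_def)
qed

lemma bicycle_free_graph_verts: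
  assumes "bicycle_free_at_radius G r" "0 \<le> r"
  shows "bicycle_free_graph (verts G) (\<lambda>u v. u \<rightarrow>\<^bsub>G\<^esub> v) (nat \<lfloor>r\<rfloor>)"
proof
  fix x assume x: "x \<in> verts G"
  then have "excess (neighborhood G r x) \<le> 0"
    using assms(1) by (auto simp: bicycle_free_at_radius_def bicycle_free_def)
  then show "card (U.edges_in (U.ball x (nat \<lfloor>r\<rfloor>))) \<le> card (U.ball x (nat \<lfloor>r\<rfloor>))"
    unfolding excess_def neighborhood_def verts_neighborhood[OF x assms(2)] uedges_induce by simp
qed

lemma card_neighbours_le:
  assumes "regular G d"
  shows "card {v. u \<rightarrow>\<^bsub>G\<^esub> v} \<le> d"
proof (cases "u \<in> verts G")
  case True
  have "{v. u \<rightarrow>\<^bsub>G\<^esub> v} \<subseteq> head G ` out_arcs G u" by (auto simp: arcs_ends_conv)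
  then have "card {v. u \<rightarrow>\<^bsub>G\<^esub> v} \<le> card (head G ` out_arcs G u)" by (intro card_mono) auto
  also have "\<dots> \<le> card (out_arcs G u)" by (intro card_image_le) auto
  also have "\<dots> = d" using assms True by (simp add: regular_def out_degree_def)
  finally show ?thesis .
next
  case False
  then have "{v. u \<rightarrow>\<^bsub>G\<^esub> v} = {}" using U.adj_V by blast
  then show ?thesis by simp
qed

lemma awalk_verts_nth:
  assumes "cas u p v" "i < length p"
  shows "awalk_verts u p ! i = tail G (p ! i)" "awalk_verts u p ! Suc i = head G (p ! i)"
proof -
  have "p \<noteq> []" using assms by auto
  then show "awalk_verts u p ! Suc i = head G (p ! i)"
    using awalk_verts_conv'[OF assms(1)] assms(2) by simp
  show "awalk_verts u p ! i = tail G (p ! i)"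
    using awalk_verts_conv[of u p] \<open>p \<noteq> []\<close> assms(2) by (simp add: nth_append)
qed

text \<open>Without parallel arcs, an arc is determined by its ends; the vertex list of an empty
  walk still records its start.\<close>

lemma inj_on_awalk_verts: "inj_on (\<lambda>(u, p). awalk_verts u p) {(u, p). \<exists>v. awalk u p v}"
proof (rule inj_onI)
  fix a b assume a: "a \<in> {(u, p). \<exists>v. awalk u p v}" and b: "b \<in> {(u, p). \<exists>v. awalk u p v}"
    and eq: "(case a of (u, p) \<Rightarrow> awalk_verts u p) = (case b of (u, p) \<Rightarrow> awalk_verts u p)"
  obtain u p v where a': "a = (u, p)" "awalk u p v" using a by auto
  obtain u' p' v' where b': "b = (u', p')" "awalk u' p' v'" using b by auto
  have vs: "awalk_verts u p = awalk_verts u' p'" using eq a' b' by simp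
  have len: "length p = length p'" using vs length_awalk_verts by (metis Suc_inject)
  have "p = p'"
  proof (rule nth_equalityI[OF len])
    fix i assume i: "i < length p"
    have "tail G (p ! i) = tail G (p' ! i)" "head G (p ! i) = head G (p' ! i)"
      using awalk_verts_nth[of u p v i] awalk_verts_nth[of u' p' v' i] a' b' i len vs
      by (auto simp: awalk_def)
    then show "p ! i = p' ! i"
      using a' b' i len by (intro no_multi_arcs) (auto simp: arc_to_ends_def awalk_def)
  qed
  moreover have "u = u'" using vs awhd_of_awalk a' b' by metis
  ultimately show "a = b" using a' b' by simp
qed

lemma card_singleton_free_hikes_0: "card (singleton_free_hikes G 0) \<le> card (verts G)"
proof -
  have "singleton_free_hikes G 0 \<subseteq> (\<lambda>u. (u, [])) ` verts G"
    by (auto simp: singleton_free_hikes_def hike_def awalk_def)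
  then have "card (singleton_free_hikes G 0) \<le> card ((\<lambda>u. (u, []::'b list)) ` verts G)"
    by (intro card_mono) auto
  also have "\<dots> \<le> card (verts G)" by (intro card_image_le) auto
  finally show ?thesis .
qed

text \<open>Consecutive arcs share a vertex, so reversing an arc means returning to the vertex two
  places earlier.\<close>

lemma hike_awalk_verts:
  assumes "hike_graph (verts G) (\<lambda>u v. u \<rightarrow>\<^bsub>G\<^esub> v) R d k" and h: "hike G k u p"
  shows "awalk_verts u p \<in> hike_graph.walks (verts G) (\<lambda>u v. u \<rightarrow>\<^bsub>G\<^esub> v) k"
    and "last (awalk_verts u p) = hd (awalk_verts u p)"
proof -
  interpret H: hike_graph "verts G" "\<lambda>u v. u \<rightarrow>\<^bsub>G\<^esub> v" R d k by fact
  have aw: "awalk u p u" and len: "length p = 2 * k"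
    and turn: "\<And>i. Suc i < length p \<Longrightarrow> Suc i \<noteq> k \<Longrightarrow> \<not> is_reverse G (p ! i) (p ! Suc i)"
    using h by (auto simp: hike_def)
  have cas: "cas u p u" using aw by (simp add: awalk_def)
  note nth = awalk_verts_nth[OF cas]
  show "last (awalk_verts u p) = hd (awalk_verts u p)" using aw by simp
  show "awalk_verts u p \<in> H.walks"
    unfolding H.walks_def
  proof (intro CollectI conjI allI impI)
    show "length (awalk_verts u p) = Suc (2 * k)" using len by (simp add: length_awalk_verts)
    show "hd (awalk_verts u p) \<in> verts G" using aw awalk_hd_in_verts by auto
    show "successively (\<lambda>u v. u \<rightarrow>\<^bsub>G\<^esub> v) (awalk_verts u p)"
      unfolding successively_conv_nth
    proof (intro allI impI)
      fix i assume "Suc i < length (awalk_verts u p)"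
      then have i: "i < length p" by (simp add: length_awalk_verts)
      then have "p ! i \<in> arcs G" using aw by (auto simp: awalk_def)
      then show "awalk_verts u p ! i \<rightarrow>\<^bsub>G\<^esub> awalk_verts u p ! Suc i"
        using nth[OF i] by (auto simp: arcs_ends_conv)
    qed
    fix i assume "Suc (Suc i) < length (awalk_verts u p) \<and> Suc i \<noteq> k"
    then have i: "Suc i < length p" "Suc i \<noteq> k" by (simp_all add: length_awalk_verts)
    have "tail G (p ! Suc i) = head G (p ! i)"
      using nth(2)[of i] nth(1)[of "Suc i"] i by simp
    then have "tail G (p ! i) \<noteq> head G (p ! Suc i)"
      using turn[OF i] by (auto simp: is_reverse_def)
    then show "awalk_verts u p ! i \<noteq> awalk_verts u p ! Suc (Suc i)"
      using nth(1)[of i] nth(2)[of "Suc i"] i by simp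
  qed
qed

text \<open>The \<open>2 * k\<close> steps are spread over edges that receive at least two
  each.\<close>

lemma singleton_free_few_edges:
  assumes "hike_graph (verts G) (\<lambda>u v. u \<rightarrow>\<^bsub>G\<^esub> v) R d k"
    and h: "hike G k u p" and sf: "singleton_free G p"
  shows "card (hike_graph.step_edge (awalk_verts u p) ` {..<2 * k}) \<le> k"
proof -
  interpret H: hike_graph "verts G" "\<lambda>u v. u \<rightarrow>\<^bsub>G\<^esub> v" R d k by fact
  have cas: "cas u p u" and len: "length p = 2 * k" using h by (auto simp: hike_def awalk_def)
  have edge: "H.step_edge (awalk_verts u p) i = uedge G (p ! i)" if "i < 2 * k" for i
    using awalk_verts_nth[OF cas, of i] that len by (simp add: H.step_edge_def uedge_def)
  have "2 * card (H.step_edge (awalk_verts u p) ` {..<2 * k}) \<le> card {..<2 * k}"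
  proof (rule card_image_ge_fibres)
    fix y assume "y \<in> H.step_edge (awalk_verts u p) ` {..<2 * k}"
    then obtain j where j: "j < 2 * k" "y = uedge G (p ! j)" using edge by auto
    have "{i \<in> {..<2 * k}. H.step_edge (awalk_verts u p) i = y} =
        {i. i < length p \<and> uedge G (p ! i) = uedge G (p ! j)}"
      using edge j len by auto
    then show "2 \<le> card {i \<in> {..<2 * k}. H.step_edge (awalk_verts u p) i = y}"
      using sf j len by (simp add: singleton_free_def)
  qed simp
  then show ?thesis by simp
qed

lemma card_singleton_free_hikes_le:
  assumes "hike_graph (verts G) (\<lambda>u v. u \<rightarrow>\<^bsub>G\<^esub> v) R d k"
  shows "card (singleton_free_hikes G k) \<le>
      card {xs \<in> hike_graph.walks (verts G) (\<lambda>u v. u \<rightarrow>\<^bsub>G\<^esub> v) k.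
        last xs = hd xs \<and> card (hike_graph.step_edge xs ` {..<2 * k}) \<le> k}"
proof (rule card_inj_on_le)
  interpret H: hike_graph "verts G" "\<lambda>u v. u \<rightarrow>\<^bsub>G\<^esub> v" R d k by fact
  show "inj_on (\<lambda>(u, p). awalk_verts u p) (singleton_free_hikes G k)"
    by (rule inj_on_subset[OF inj_on_awalk_verts]) (auto simp: singleton_free_hikes_def hike_def)
  show "finite {xs \<in> H.walks. last xs = hd xs \<and> card (H.step_edge xs ` {..<2 * k}) \<le> k}"
    using H.finite_walks by simp
  show "(\<lambda>(u, p). awalk_verts u p) ` singleton_free_hikes G k \<subseteq>
    {xs \<in> H.walks. last xs = hd xs \<and> card (H.step_edge xs ` {..<2 * k}) \<le> k}"
    using hike_awalk_verts[OF assms] singleton_free_few_edges[OF assms]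
    by (auto simp: singleton_free_hikes_def)
qed

end

section \<open>The bound\<close>

lemma half_le_ln_2: "1 / 2 \<le> ln (2::real)"
proof -
  have "exp (1 / 2) ^ 2 = exp (1::real)" by (simp flip: exp_double)
  also have "\<dots> \<le> 2 ^ 2" using exp_le by simp
  finally have "exp (1 / 2) \<le> (2::real)" by (rule power2_le_imp_le) simp
  then show ?thesis using ln_ge_iff[of 2 "1 / 2"] by simp
qed

text \<open>With \<open>\<delta> = 2 ln l / R \<le> 1\<close>, the bound
  \<open>ln (1 + \<delta>) \<ge> \<delta> / 2\<close> gives
  \<open>R * ln (1 + \<delta>) \<ge> ln l\<close>.\<close>

lemma growth_exceeds:
  fixes l R :: nat
  assumes l: "2 \<le> l" and R: "2 * ln (real l) \<le> real R"
  shows "real l \<le> (1 + 2 * ln (real l) / real R) ^ R"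
proof -
  let ?\<delta> = "2 * ln (real l) / real R"
  have ln: "0 < ln (real l)" using l by simp
  then have R0: "0 < real R" using R by linarith
  have \<delta>: "0 \<le> ?\<delta>" "?\<delta> \<le> 1" using ln R R0 by simp_all
  \<comment> \<open>Applying \<open>ln x \<le> x - 1\<close> to the reciprocal yields a lower bound
    for \<open>ln (1 + \<delta>)\<close>.\<close>
  have "ln (1 / (1 + ?\<delta>)) \<le> 1 / (1 + ?\<delta>) - 1" using \<delta> by (intro ln_le_minus_one) auto
  then have "1 - 1 / (1 + ?\<delta>) \<le> ln (1 + ?\<delta>)" using \<delta> by (simp add: ln_div)
  moreover have "x / 2 \<le> 1 - 1 / (1 + x)" if "0 \<le> x" "x \<le> 1" for x :: real
    using that mult_left_mono[of x 1 x] by (simp add: field_simps)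
  ultimately have "?\<delta> / 2 \<le> ln (1 + ?\<delta>)" using \<delta> by (meson order_trans)
  then have "ln (real l) \<le> real R * ln (1 + ?\<delta>)" using R0 by (simp add: field_simps)
  then have "exp (ln (real l)) \<le> exp (real R * ln (1 + ?\<delta>))" by simp
  also have "\<dots> = (1 + ?\<delta>) ^ R" using \<delta> by (simp add: exp_of_nat_mult)
  finally show ?thesis using l by simp
qed

text \<open>Every term is compared with \<open>\<tau> = l * ln l / r\<close>, which is at least
  \<open>1 / 2\<close> because \<open>r \<le> l\<close>. With \<open>q \<le> 2 + 4 * \<tau>\<close>
  and \<open>m \<le> 8 * \<tau>\<close> the sum is at most \<open>14 + 32 * \<tau>\<close>, hence at
  most \<open>60 * \<tau>\<close>.\<close>

lemma exponent_le:
  fixes l r :: real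
  assumes l: "2 \<le> l" and r: "2 \<le> r" "r \<le> l" and R: "r - 1 \<le> R"
    and q: "q \<le> 2 + 2 * ln l / R * l" and m: "m \<le> 2 * l / R"
  shows "2 + 2 * q + 2 * (q + 2 + m) \<le> 60 * (ln l / r) * l"
proof -
  have ln: "1 / 2 \<le> ln l" using half_le_ln_2 ln_mono[of 2 l] l by linarith
  have R2: "r / 2 \<le> R" "0 < R" using R r by linarith+
  define \<tau> where "\<tau> = ln l / r * l"
  have inv: "1 / R \<le> 2 / r" using R2 r by (simp add: field_simps)
  have "2 * ln l / R * l = 2 * ln l * l * (1 / R)" by simp
  also have "\<dots> \<le> 2 * ln l * l * (2 / r)" using inv ln l by (intro mult_left_mono) auto
  finally have 1: "2 * ln l / R * l \<le> 4 * \<tau>" by (simp add: \<tau>_def)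
  have "2 * l / R = 2 * l * (1 / R)" by simp
  also have "\<dots> \<le> 2 * l * (2 / r)" using inv l by (intro mult_left_mono) auto
  also have "\<dots> \<le> 2 * l * (2 / r) * (2 * ln l)"
    using ln l r mult_left_mono[of 1 "2 * ln l" "2 * l * (2 / r)"] by simp
  finally have 2: "2 * l / R \<le> 8 * \<tau>" by (simp add: \<tau>_def mult.commute)
  have "1 / 2 * 1 \<le> ln l * (l / r)" using ln l r by (intro mult_mono) auto
  then have 3: "1 / 2 \<le> \<tau>" by (simp add: \<tau>_def)
  have "q \<le> 2 + 4 * \<tau>" using order_trans[OF q add_left_mono[OF 1]] .
  moreover have "m \<le> 8 * \<tau>" using order_trans[OF m 2] .
  ultimately have "2 + 2 * q + 2 * (q + 2 + m) \<le> 60 * \<tau>" using 3 by simp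
  also have "\<dots> = 60 * (ln l / r) * l" by (simp add: \<tau>_def)
  finally show ?thesis .
qed

theorem theorem3p9:
  shows "\<exists>C\<^sub>1 > (0::real). \<exists>C\<^sub>2 > (0::real).
    \<forall>(G :: ('a, 'b) pre_digraph) (n::nat) (d::nat) (l::nat) (r::real).
      graph G \<longrightarrow> card (verts G) = n \<longrightarrow> regular G d \<longrightarrow> 2 \<le> d \<longrightarrow> 1 \<le> l \<longrightarrow>
      10 * ln (2 * real l) \<le> r \<longrightarrow> bicycle_free_at_radius G r \<longrightarrow>
      real (card (singleton_free_hikes G (l - 1)))
        \<le> C\<^sub>1 * (real l ^ 3 * real n) * (real d - 1) ^ l
            * (real d * r * real l) powr (C\<^sub>2 * (ln (real l) / r) * real l)"
proof -
  have "real (card (singleton_free_hikes G (l - 1)))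
        \<le> 4 * (real l ^ 3 * real n) * (real d - 1) ^ l
            * (real d * r * real l) powr (60 * (ln (real l) / r) * real l)"
    if G: "graph G" and n: "card (verts G) = n" and reg: "regular G d" and d: "2 \<le> d"
      and l: "1 \<le> l" and r: "10 * ln (2 * real l) \<le> r" and bf: "bicycle_free_at_radius G r"
    for G :: "('a, 'b) pre_digraph" and n d l :: nat and r :: real
  proof -
    interpret graph G by (rule G)
    define k R where "k = l - 1" and "R = nat \<lfloor>r\<rfloor>"
    define Q where "Q = real d * r * real l"
    define pw where "pw = Q powr (60 * (ln (real l) / r) * real l)"
    have r5: "5 \<le> r"
    proof -
      have "ln 2 \<le> ln (2 * real l)" using l by simp
      then show ?thesis using r half_le_ln_2 by linarith
    qed
    have dr: "real (d - 1) = real d - 1" "1 \<le> real d - 1" using d by auto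
    have l1: "1 \<le> real l" using l by simp
    have dl: "real d \<le> Q" "2 * real l \<le> Q" "1 \<le> Q"
    proof -
      have "real d * 1 \<le> real d * (r * real l)" using r5 l1 mult_mono[of 1 r 1 "real l"] by (intro mult_left_mono) auto
      then show "real d \<le> Q" by (simp add: Q_def ac_simps)
      then show "1 \<le> Q" using d by linarith
      have "2 * 1 * real l \<le> real d * r * real l" using d r5 by (intro mult_mono) auto
      then show "2 * real l \<le> Q" by (simp add: Q_def)
    qed
    have pw1: "1 \<le> pw"
      unfolding pw_def using dl l r5 by (intro ge_one_powr_ge_zero) auto
    have goal: ?thesis if "real (card (singleton_free_hikes G k)) \<le> 4 * real l ^ 3 * real n * (real d - 1) ^ l * pw"
      using that by (simp add: k_def pw_def Q_def mult.assoc)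
    have l3: "real l \<le> real l ^ 3" using l1 by (simp add: self_le_power)
    show ?thesis
    proof (cases "l = 1")
      case True
      have "real (card (singleton_free_hikes G k)) \<le> real n"
        using card_singleton_free_hikes_0 n True by (simp add: k_def)
      also have "\<dots> \<le> 4 * real l ^ 3 * real n * (real d - 1) ^ l * pw"
      proof -
        have "1 \<le> 4 * (real d - 1) * pw" using dr pw1 mult_mono[of 1 "4 * (real d - 1)" 1 pw] by simp
        then have "real n * 1 \<le> real n * (4 * (real d - 1) * pw)" by (intro mult_left_mono) auto
        then show ?thesis using True by (simp add: ac_simps)
      qed
      finally show ?thesis by (rule goal)
    next
      case False
      then have l2: "2 \<le> l" and lk: "l = Suc k" and k0: "0 < k" using l by (auto simp: k_def)
      have R: "real R \<le> r" "r - 1 \<le> real R" "0 < R" using r5 unfolding R_def by linarith+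
      interpret B: bicycle_free_graph "verts G" "\<lambda>u v. u \<rightarrow>\<^bsub>G\<^esub> v" R
        unfolding R_def using bf r5 by (intro bicycle_free_graph_verts) auto
      interpret H: hike_graph "verts G" "\<lambda>u v. u \<rightarrow>\<^bsub>G\<^esub> v" R d k
        using card_neighbours_le[OF reg] d k0 R by unfold_locales auto
      note le = card_singleton_free_hikes_le[OF H.hike_graph_axioms]
      show ?thesis
      proof (cases "k \<le> R")
        case True
        note le
        also have "card {xs \<in> H.walks. last xs = hd xs \<and> card (H.step_edge xs ` {..<2 * k}) \<le> k}
            \<le> card {xs \<in> H.walks. last xs = hd xs}"
          using H.finite_walks by (intro card_mono) auto
        also have "\<dots> \<le> n * d * (d - 1) ^ (k - 1) * (2 * Suc k)"
          using H.card_closed_walks_le[OF True] n by simp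
        \<comment> \<open>The unrestricted first step is absorbed by
          \<open>d \<le> 2 * (d - 1)\<close>, valid for \<open>d \<ge> 2\<close>.\<close>
        also have "\<dots> \<le> n * (2 * (d - 1)) * (d - 1) ^ (k - 1) * (2 * Suc k)"
          using d by (intro mult_le_mono) auto
        also have "\<dots> = 4 * l * n * (d - 1) ^ k"
        proof -
          have "n * (2 * c) * x * (2 * Suc k) = 4 * Suc k * n * (c * x)" for c x by (simp add: algebra_simps)
          moreover have "(d - 1) ^ k = (d - 1) * (d - 1) ^ (k - 1)" using k0 by (simp add: power_eq_if)
          ultimately show ?thesis by (simp only: lk)
        qed
        also have "\<dots> \<le> 4 * l * n * (d - 1) ^ l"
          using d lk by (intro mult_le_mono2 power_increasing) auto
        finally have "real (card (singleton_free_hikes G k)) \<le> real (4 * l * n * (d - 1) ^ l)"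
          by (rule of_nat_mono)
        also have "\<dots> = 4 * real l * real n * (real d - 1) ^ l * 1" using dr by simp
        also have "\<dots> \<le> 4 * real l ^ 3 * real n * (real d - 1) ^ l * pw"
          using l3 pw1 dr by (intro mult_mono) auto
        finally show ?thesis by (rule goal)
      next
        case False
        then have rl: "r \<le> real l" using R lk by linarith
        define \<delta> where "\<delta> = 2 * ln (real l) / real R"
        define q where "q = nat \<lfloor>2 + \<delta> * real l\<rfloor>"
        have lnl: "0 \<le> ln (real l)" using l1 by simp
        have "ln (real l) \<le> ln (2 * real l)" using l1 by simp
        \<comment> \<open>From \<open>r \<ge> 10 ln (2 l)\<close> and \<open>r \<ge> 5\<close>:
          twice \<open>ln l\<close> is at most \<open>r / 5\<close>, which is at most
          \<open>r - 1\<close>.\<close>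
        then have "2 * ln (real l) \<le> real R" using r R lnl r5 by linarith
        then have \<delta>: "0 \<le> \<delta>" "real (Suc k) \<le> (1 + \<delta>) ^ R"
          using growth_exceeds[OF l2, of R] lnl lk unfolding \<delta>_def by auto
        have "0 \<le> \<delta> * real l" using \<delta>(1) by simp
        then have q: "2 + \<delta> * real (Suc k) < real (Suc q)" "real q \<le> 2 + \<delta> * real l"
          unfolding q_def lk[symmetric] by linarith+
        let ?e = "q + 2 + 2 * k div R"
        note le
        also have "card {xs \<in> H.walks. last xs = hd xs \<and> card (H.step_edge xs ` {..<2 * k}) \<le> k}
            \<le> card {xs \<in> H.walks. card (H.step_edge xs ` {..<2 * k}) \<le> k}"
          using H.finite_walks by (intro card_mono) auto
        also have "\<dots> \<le> n * d\<^sup>2 * (d - 1) ^ k * (Suc (2 * k) ^ (2 * q) * H.segment_factor ^ ?e)"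
          using H.card_walks_few_edges_le[OF \<delta> q(1)] n by simp
        also have "\<dots> \<le> n * d\<^sup>2 * (d - 1) ^ l * (Suc (2 * k) ^ (2 * q) * H.segment_factor ^ ?e)"
          using d lk by (intro mult_le_mono1 mult_le_mono2 power_increasing) auto
        finally have "real (card (singleton_free_hikes G k)) \<le>
            real (n * d\<^sup>2 * (d - 1) ^ l * (Suc (2 * k) ^ (2 * q) * H.segment_factor ^ ?e))"
          by (rule of_nat_mono)
        also have "\<dots> = real n * (real d - 1) ^ l *
            (real d ^ 2 * (real (Suc (2 * k)) ^ (2 * q) * real H.segment_factor ^ ?e))"
          using dr by (simp add: ac_simps)
        \<comment> \<open>All remaining factors become powers of \<open>Q = d * r * l\<close>. Both
          \<open>2k + 1\<close> and \<open>2 * Suc R\<close> are at most \<open>Q\<close>, the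
          latter by \<open>4 * r \<le> d * r * l\<close>, so a segment costs at most
          \<open>Q ^ 2\<close>.\<close>
        also have "\<dots> \<le> real n * (real d - 1) ^ l * (Q ^ 2 * (Q ^ (2 * q) * (Q ^ 2) ^ ?e))"
        proof -
          have "real (Suc (2 * k)) \<le> 2 * real l" using lk by simp
          then have 1: "real (Suc (2 * k)) \<le> Q" using dl by linarith
          have "real (2 * Suc R) \<le> 4 * r" using R r5 by simp
          also have "\<dots> = 2 * r * 2" by simp
          also have "\<dots> \<le> Q" unfolding Q_def using d r5 l2 by (intro mult_mono) auto
          finally have 2: "real (2 * Suc R) \<le> Q" .
          have "real H.segment_factor \<le> Q * Q"
            unfolding H.segment_factor_def of_nat_mult[of "Suc (2 * k)"] using 1 2 dl by (intro mult_mono) auto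
          then show ?thesis using 1 dl dr
            by (intro mult_left_mono mult_mono power_mono) (auto simp: power2_eq_square)
        qed
        also have "Q ^ 2 * (Q ^ (2 * q) * (Q ^ 2) ^ ?e) = Q ^ (2 + 2 * q + 2 * ?e)"
          by (simp only: power_add power_mult mult.assoc)
        also have "\<dots> = Q powr real (2 + 2 * q + 2 * ?e)"
          using dl by (subst powr_realpow) auto
        also have "\<dots> \<le> pw"
          unfolding pw_def
        proof (rule powr_mono)
          have "real (2 * k div R) \<le> real (2 * k) / real R" by (rule of_nat_div_le_of_nat)
          also have "\<dots> \<le> 2 * real l / real R" using lk by (intro divide_right_mono) auto
          finally have "2 + 2 * real q + 2 * (real q + 2 + real (2 * k div R)) \<le> 60 * (ln (real l) / r) * real l"
            using exponent_le[of "real l" r "real R" "real q" "real (2 * k div R)"] l2 r5 rl R q(2)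
            by (simp add: \<delta>_def)
          then show "real (2 + 2 * q + 2 * ?e) \<le> 60 * (ln (real l) / r) * real l" by simp
        qed (use dl in auto)
        finally have "real (card (singleton_free_hikes G k)) \<le> real n * (real d - 1) ^ l * pw"
          using dr by (simp add: mult_left_mono)
        also have "\<dots> \<le> 4 * real l ^ 3 * (real n * (real d - 1) ^ l * pw)"
        proof -
          have "1 \<le> 4 * real l ^ 3" using l1 l3 by linarith
          moreover have "0 \<le> real n * (real d - 1) ^ l * pw" using dr pw1 by simp
          ultimately show ?thesis
            using mult_right_mono[of 1 "4 * real l ^ 3" "real n * (real d - 1) ^ l * pw"] by simp
        qed
        finally show ?thesis by (intro goal) (simp add: ac_simps)
      qed
    qed
  qed
  then show ?thesis by (intro exI[of _ 4] conjI exI[of _ 60] allI impI) auto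
qed

end
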